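(* Let $A:\mathcal{H}\to 2^{\mathcal{H}}$ be maximally monotone, let $u,x_0\in\mathcal{H}$, let $(e_k)_{k\in\mathbb{N}}$ be a sequence in $\mathcal{H}$, let $(c_k)_{k\in\mathbb{N}}$ be a sequence of strictly positive reals, let $(\alpha_k)_{k\in\mathbb{N}},(\beta_k)_{k\in\mathbb{N}},(\gamma_k)_{k\in\mathbb{N}},(\delta_k)_{k\in\mathbb{N}}$ be sequences in $\mathbb{R}$, and let $(x_k)_{k\in\mathbb{N}}$ be generated by $$(\forall k\in\mathbb{N})\quad x_{k+1}=\alpha_k u+\beta_k x_k+\gamma_k J_{c_kA}(x_k)+\delta_k e_k .$$ Assume that one of the following (I)–(V) is satisfied. (I) $\limsup_{k\to\infty}\left(\left|\beta_k+\frac{\gamma_k}{2}\right|+\left|\frac{\gamma_k}{2}\right|\right)<1$, $\sup_{k\in\mathbb{N}}|\alpha_k|<\infty$, and $\sup_{k\in\mathbb{N}}\|\delta_ke_k\|<\infty$. (II) $(\forall k\in\mathbb{N})$ $\left|\beta_k+\frac{\gamma_k}{2}\right|+\left|\frac{\gamma_k}{2}\right|\le 1$, and all of the following hold: (a) $\left[(\forall k\in\mathbb{N})\ |\alpha_k|+\left|\beta_k+\frac{\gamma_k}{2}\right|+\left|\frac{\gamma_k}{2}\right|\le 1\right]$ or $\sum_{i\in\mathbb{N}}|\alpha_i|<\infty$; (b) $\left[(\forall k\in\mathbb{N})\ \left|\beta_k+\frac{\gamma_k}{2}\right|+\left|\frac{\gamma_k}{2}\right|+|\delta_k|\le 1\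 \text{and}\ \sup_{i\in\mathbb{N}}\|e_i\|<\infty\right]$ or $\sum_{i\in\mathbb{N}}\|\delta_ie_i\|<\infty$; (c) $\left[(\forall k\in\mathbb{N})\ \left|\beta_k+\frac{\gamma_k}{2}\right|+\left|\frac{\gamma_k}{2}\right|+|1-\beta_k-\gamma_k|\le 1\right]$ or $\sum_{i\in\mathbb{N}}|1-\beta_i-\gamma_i|<\infty$. (III) $(\forall k\in\mathbb{N})$ $|\alpha_k|+\left|\beta_k+\frac{\gamma_k}{2}\right|+\left|\frac{\gamma_k}{2}\right|\le 1$, $\sum_{k\in\mathbb{N}}|1-\alpha_k-\beta_k-\gamma_k|<\infty$, and $\sum_{k\in\mathbb{N}}\|\delta_ke_k\|<\infty$. (IV) $\sup_{k\in\mathbb{N}}\|e_k\|<\infty$, $\sum_{k\in\mathbb{N}}|\alpha_k|<\infty$, $\sum_{k\in\mathbb{N}}|1-\beta_k-\gamma_k-\delta_k|<\infty$, and $(\forall k\in\mathbb{N})$ $\left|\beta_k+\frac{\gamma_k}{2}\right|+\left|\frac{\gamma_k}{2}\right|+|\delta_k|\le 1$. (V) $(\forall k\in\mathbb{N})$ $\alpha_k\in\left]0,1\right]$ and $\alpha_k+\left|\beta_k+\frac{\gamma_k}{2}\right|+\left|\frac{\gamma_k}{2}\right|\le 1$, $\frac{\delta_ke_k}{\alpha_k}\to 0$, and $\frac{1-\alpha_k-\beta_k-\gamma_k}{\alpha_k}\to 0$. Then the following statements hold. (i) $\operatorname{zer}A\neq\varnothing$ implies the boundedness of $(x_k)_{k\in\mathbb{N}}$.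 (ii) Suppose additionally that one of the following holds. (a) $c_k\to\infty$, $\alpha_k\to 0$, $\beta_k\to 0$, $\gamma_k\to 1$, and $\delta_ke_k\to 0$. (b) $(\forall k\in\mathbb{N})$ $\beta_k+\gamma_k\le 1$, $\alpha_k\to 0$, $\limsup_{k\to\infty}|\beta_k|<1$, $1-\alpha_k-\beta_k-\gamma_k\to 0$, $0<\liminf_{k\to\infty}\left(1-\beta_k-\frac{\gamma_k}{2}\right)\le\limsup_{k\to\infty}\left(1-\beta_k-\frac{\gamma_k}{2}\right)<1$, $\delta_ke_k\to 0$, $1-\frac{c_k}{c_{k+1}}\to 0$, and [$\inf_{k\in\mathbb{N}}c_k>0$ or $c_k\to\infty$]. (c) $\sum_{i\in\mathbb{N}}|\alpha_{i+1}-\alpha_i|<\infty$ or [$(\forall k\in\mathbb{N})$ $|\gamma_k|\ne 1$ with $\lim_{k\to\infty}\frac{|\alpha_{k+1}-\alpha_k|}{1-|\gamma_{k+1}|}=0$]; $(\forall k\in\mathbb{N})$ $|\gamma_k|\in[0,1]$; $\alpha_k\to 0$ and $\alpha_k+\gamma_k\to 1$; $\sum_{k\in\mathbb{N}}|(\alpha_{k+1}+\gamma_{k+1})-(\alpha_k+\gamma_k)|<\infty$, $\sum_{k\in\mathbb{N}}|\beta_k|<\infty$, $\sum_{k\in\mathbb{N}}(1-|\gamma_k|)=\infty$, and $\sum_{k\in\mathbb{N}}\|\delta_ke_k\|<\infty$; and $\inf_{k\in\mathbb{N}}c_k>0$ and $\sum_{k\in\mathbb{N}}|c_{k+1}-c_k|<\infty$.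 Then $\operatorname{zer}A\neq\varnothing$ if and only if $(x_k)_{k\in\mathbb{N}}$ is bounded.
   Context: $\mathcal{H}\neq\{0\}$ is a real Hilbert space with inner product $\langle\cdot,\cdot\rangle$ and induced norm $\|\cdot\|$; $\mathbb{N}=\{0,1,2,\ldots\}$. A set-valued operator $A:\mathcal{H}\to 2^{\mathcal{H}}$ has graph $\operatorname{gra}A=\{(x,w): w\in A(x)\}$; it is monotone if $\langle x-y,w-v\rangle\ge 0$ for all $(x,w),(y,v)\in\operatorname{gra}A$, and maximally monotone if moreover no monotone operator has a graph properly containing $\operatorname{gra}A$. $\operatorname{zer}A=\{x\in\mathcal{H}: 0\in A(x)\}$. For $c>0$, $J_{cA}=(\mathrm{Id}+cA)^{-1}$ is the resolvent of $cA$; for $A$ maximally monotone it is a single-valued map defined on all of $\mathcal{H}$. *)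

theory Defs
  imports "HOL-Analysis.Analysis"
begin

definition gra :: "('a \<Rightarrow> 'a set) \<Rightarrow> ('a \<times> 'a) set" where
  "gra A = {(x, w). w \<in> A x}"

definition monotone_operator :: "('a::real_inner \<Rightarrow> 'a set) \<Rightarrow> bool" where
  "monotone_operator A \<longleftrightarrow>
     (\<forall>(x, w) \<in> gra A. \<forall>(y, v) \<in> gra A. inner (x - y) (w - v) \<ge> 0)"

definition maximally_monotone :: "('a::real_inner \<Rightarrow> 'a set) \<Rightarrow> bool" where
  "maximally_monotone A \<longleftrightarrow>
     monotone_operator A \<and> \<not> (\<exists>B. monotone_operator B \<and> gra A \<subset> gra B)"

definition zer :: "('a::zero \<Rightarrow> 'a set) \<Rightarrow> 'a set" where
  "zer A = {x. 0 \<in> A x}"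

definition scale_operator :: "real \<Rightarrow> ('a \<Rightarrow> 'a::real_vector set) \<Rightarrow> 'a \<Rightarrow> 'a set" where
  "scale_operator c A x = (\<lambda>w. c *\<^sub>R w) ` A x"

definition Id_plus :: "('a \<Rightarrow> 'a::plus set) \<Rightarrow> 'a \<Rightarrow> 'a set" where
  "Id_plus A x = (\<lambda>w. x + w) ` A x"

definition inverse_operator :: "('a \<Rightarrow> 'a set) \<Rightarrow> 'a \<Rightarrow> 'a set" where
  "inverse_operator A y = {x. y \<in> A x}"

text \<open>
  The set-valued resolvent \<open>(Id + A)\<^sup>-\<^sup>1\<close>, and the resolvent as a point-to-point map.
  The latter is meaningful where the former is a singleton; for a maximally monotone
  operator (and its positive multiples) this is the case everywhere, by Minty's theorem.
\<close>

definition resolvent_set :: "('a \<Rightarrow> 'a::plus set) \<Rightarrow> 'a \<Rightarrow> 'a set" where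
  "resolvent_set A = inverse_operator (Id_plus A)"

definition resolvent :: "('a \<Rightarrow> 'a::plus set) \<Rightarrow> 'a \<Rightarrow> 'a" where
  "resolvent A x = the_elem (resolvent_set A x)"

end

theory Submission
  imports Defs
begin

text \<open>
  Throughout, put \<open>y\<^sub>k = J\<^bsub>c\<^sub>kA\<^esub>(x\<^sub>k)\<close>, \<open>w\<^sub>k = (x\<^sub>k - y\<^sub>k) / c\<^sub>k\<close> and
  \<open>\<rho>\<^sub>k = \<bar>\<beta>\<^sub>k + \<gamma>\<^sub>k/2\<bar> + \<bar>\<gamma>\<^sub>k/2\<bar>\<close>.

  Resolvents of a maximally monotone operator are everywhere defined (Minty), so that
  \<open>w\<^sub>k \<in> A y\<^sub>k\<close>. Writing \<open>w = z - x\<close>, the condition \<open>z - x \<in> A x\<close> asks for a point lying in all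
  balls of a family indexed by the graph of \<open>A\<close>. Such a point is obtained from a minimising sequence
  of a function that is convex on the convex hull of the graph (with \<open>\<langle>a, b\<rangle>\<close> as additional
  coordinate), and uniformly so in the direction \<open>a - b\<close>: this makes the sequence of the \<open>a - b\<close>
  Cauchy (\<open>minty_surjective\<close>).

  For boundedness, let \<open>p\<close> be a zero of \<open>A\<close>. The reflected resolvents \<open>2J - Id\<close> do not increase the
  distance to \<open>p\<close>, so \<open>\<parallel>x\<^sub>k\<^sub>+\<^sub>1 - p\<parallel> \<le> \<rho>\<^sub>k \<parallel>x\<^sub>k - p\<parallel> + \<parallel>r\<^sub>k\<parallel>\<close>, where
  \<open>r\<^sub>k = \<alpha>\<^sub>k u + \<delta>\<^sub>k e\<^sub>k - (1 - \<beta>\<^sub>k - \<gamma>\<^sub>k) p\<close>. Each of the alternative assumptions on the parameters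
  bounds the residual by \<open>\<parallel>r\<^sub>k\<parallel> \<le> (1 - \<rho>\<^sub>k) M + s\<^sub>k\<close> with summable \<open>s\<close> (\<open>residual_absorbable\<close>). Up to
  summable errors the new distance is then at most a convex combination of the old one and \<open>M\<close>,
  hence stays bounded (\<open>perturbed_averaging_bounded\<close>).

  For the converse, suppose that \<open>x\<close> is bounded. In all three situations \<open>\<alpha>\<^sub>k \<rightarrow> 0\<close>,
  \<open>\<beta>\<^sub>k + \<gamma>\<^sub>k \<rightarrow> 1\<close>, \<open>\<delta>\<^sub>k e\<^sub>k \<rightarrow> 0\<close>, and eventually \<open>0 < g \<le> \<gamma>\<^sub>k \<le> 2\<close> and \<open>0 < m \<le> c\<^sub>k\<close>; these properties
  suffice. They turn the recursion into \<open>x\<^sub>k\<^sub>+\<^sub>1 = x\<^sub>k - \<gamma>\<^sub>k c\<^sub>k w\<^sub>k + \<epsilon>\<^sub>k\<close> with \<open>\<epsilon>\<^sub>k \<rightarrow> 0\<close>, and for any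
  \<open>b \<in> A a\<close> monotonicity gives
  \<open>\<parallel>x\<^sub>k\<^sub>+\<^sub>1 - a\<parallel>\<^sup>2 \<le> \<parallel>x\<^sub>k - a\<parallel>\<^sup>2 - 2 \<gamma>\<^sub>k c\<^sub>k \<langle>y\<^sub>k - a, b\<rangle> + o(1)\<close>. If \<open>\<langle>y\<^sub>k - a, b\<rangle>\<close> were
  eventually at least some \<open>\<eta> > 0\<close>, the left-hand side would tend to minus infinity; thus
  \<open>\<langle>y\<^sub>k - a, b\<rangle> < \<eta>\<close> infinitely often (\<open>frequently_inner_less\<close>). Now take \<open>a = z\<^sub>n = J\<^bsub>tA\<^esub>(0)\<close> and
  \<open>b = - z\<^sub>n/t\<close> with \<open>t = n + 1\<close>: it follows that \<open>\<parallel>z\<^sub>n\<parallel>\<close> is at most an eventual bound of \<open>\<parallel>y\<^sub>k\<parallel>\<close>, for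
  every \<open>n\<close>. Finally, a bounded sequence \<open>z\<^sub>n\<close> of this kind converges strongly to a zero of \<open>A\<close>
  (\<open>zer_nonempty_if_bounded_approximants\<close>).
\<close>

section \<open>Maximally monotone operators and their resolvents\<close>

lemma monotone_operatorD:
  assumes "monotone_operator A" "w \<in> A x" "v \<in> A y"
  shows "inner (x - y) (w - v) \<ge> 0"
  using assms unfolding monotone_operator_def gra_def by fastforce

text \<open>
  A point that is monotonically related to the whole graph can be added to it without destroying
  monotonicity, so by maximality it is already there.
\<close>

lemma maximally_monotoneD:
  assumes A: "maximally_monotone A"
    and rel: "\<And>a b. b \<in> A a \<Longrightarrow> inner (x - a) (w - b) \<ge> 0"
  shows "w \<in> A x"
proof (rule ccontr)
  assume w: "w \<notin> A x"
  define B where "B = A(x := insert w (A x))"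
  have mono: "\<And>a b a' b'. b \<in> A a \<Longrightarrow> b' \<in> A a' \<Longrightarrow> inner (a - a') (b - b') \<ge> 0"
    using A monotone_operatorD unfolding maximally_monotone_def by blast
  have rel': "inner (a - x) (b - w) \<ge> 0" if "b \<in> A a" for a b
    using rel[OF that] by (simp add: inner_diff_left inner_diff_right)
  have B: "b \<in> B a \<longleftrightarrow> b \<in> A a \<or> (a = x \<and> b = w)" for a b
    by (auto simp: B_def)
  have "monotone_operator B"
    unfolding monotone_operator_def gra_def using mono rel rel' by (auto simp: B)
  moreover have "gra A \<subset> gra B"
    using w by (auto simp: gra_def B)
  ultimately show False
    using A unfolding maximally_monotone_def by blast
qed

lemma maximally_monotone_imp_monotone: "maximally_monotone A \<Longrightarrow> monotone_operator A"
  by (simp add: maximally_monotone_def)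

lemma maximally_monotoneI:
  assumes "monotone_operator A"
    and "\<And>x w. (\<And>a b. b \<in> A a \<Longrightarrow> inner (x - a) (w - b) \<ge> 0) \<Longrightarrow> w \<in> A x"
  shows "maximally_monotone A"
  unfolding maximally_monotone_def
proof (intro conjI notI)
  assume "\<exists>B. monotone_operator B \<and> gra A \<subset> gra B"
  then obtain B x w where B: "monotone_operator B" "gra A \<subseteq> gra B" and w: "w \<in> B x" "w \<notin> A x"
    by (auto simp: gra_def)
  have "inner (x - a) (w - b) \<ge> 0" if "b \<in> A a" for a b
  proof -
    have "b \<in> B a" using B(2) that by (auto simp: gra_def)
    then show ?thesis using monotone_operatorD[OF B(1) w(1)] by blast
  qed
  then show False using assms(2) w(2) by blast
qed fact

lemma maximally_monotone_scale:
  assumes A: "maximally_monotone A" and c: "c > 0"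
  shows "maximally_monotone (scale_operator c A)"
proof (rule maximally_monotoneI)
  show "monotone_operator (scale_operator c A)"
    unfolding monotone_operator_def gra_def scale_operator_def
  proof clarsimp
    fix x y w v assume "w \<in> A x" "v \<in> A y"
    then have "inner (x - y) (w - v) \<ge> 0"
      using A maximally_monotone_imp_monotone monotone_operatorD by blast
    moreover have "inner (x - y) (c *\<^sub>R w - c *\<^sub>R v) = c * inner (x - y) (w - v)"
      by (simp add: inner_diff_right right_diff_distrib)
    ultimately show "0 \<le> inner (x - y) (c *\<^sub>R w - c *\<^sub>R v)"
      using c by simp
  qed
next
  fix x w assume rel: "\<And>a b. b \<in> scale_operator c A a \<Longrightarrow> inner (x - a) (w - b) \<ge> 0"
  have "w /\<^sub>R c \<in> A x"
  proof (rule maximally_monotoneD[OF A])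
    fix a b assume "b \<in> A a"
    then have "inner (x - a) (w - c *\<^sub>R b) \<ge> 0"
      using rel by (auto simp: scale_operator_def)
    moreover have "w - c *\<^sub>R b = c *\<^sub>R (w /\<^sub>R c - b)"
      using c by (simp add: scaleR_right_diff_distrib)
    ultimately show "inner (x - a) (w /\<^sub>R c - b) \<ge> 0"
      using c by (simp add: zero_le_mult_iff)
  qed
  then have "c *\<^sub>R (w /\<^sub>R c) \<in> scale_operator c A x"
    unfolding scale_operator_def by (rule imageI)
  then show "w \<in> scale_operator c A x"
    using c by simp
qed

text \<open>
  The graph of \<open>A\<close> with the duality product as an extra coordinate: on its convex hull the third
  coordinate records the average of \<open>\<langle>a, b\<rangle>\<close>, which has to be compared with the product of the
  averages.
\<close>

definition lifted_graph :: "('a::real_inner \<Rightarrow> 'a set) \<Rightarrow> ('a \<times> 'a \<times> real) set" where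
  "lifted_graph A = {(a, b, inner a b) | a b. b \<in> A a}"

text \<open>
  Two points \<open>(x, y, r)\<close> and \<open>(a, b, s)\<close> are called compatible here if
  \<open>\<langle>x, b\<rangle> + \<langle>a, y\<rangle> \<le> r + s\<close>. For fixed \<open>(a, b, s)\<close> this is a half-space condition on \<open>(x, y, r)\<close>,
  and for two points of the lifted graph it is exactly monotonicity. Passing to the hull in one
  argument and then in the other shows that any two points of the hull are compatible; the claim is
  compatibility of a point with itself.
\<close>

lemma lifted_graph_hull:
  assumes A: "monotone_operator A" and X: "(a, b, r) \<in> convex hull lifted_graph A"
  shows "inner a b \<le> r"
proof -
  define K where "K S = {(x, y, r). \<forall>(a, b, s) \<in> S. inner x b + inner a y \<le> r + s}"
    for S :: "('a \<times> 'a \<times> real) set"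
  have K: "convex (K S)" for S
  proof -
    have "convex {(x, y, r). inner x b + inner a y \<le> r + s}" for a b :: 'a and s
    proof (clarsimp simp: convex_def)
      fix x y r x' y' r' and t t' :: real
      assume h: "inner x b + inner a y \<le> r + s" "inner x' b + inner a y' \<le> r' + s"
        and t: "0 \<le> t" "0 \<le> t'" "t + t' = 1"
      have "t * (inner x b + inner a y) + t' * (inner x' b + inner a y') \<le> t * (r + s) + t' * (r' + s)"
        using h t by (intro add_mono[OF mult_left_mono mult_left_mono])
      also have "\<dots> = t * r + t' * r' + (t + t') * s"
        by (simp only: algebra_simps)
      finally show "inner (t *\<^sub>R x + t' *\<^sub>R x') b + inner a (t *\<^sub>R y + t' *\<^sub>R y') \<le> t * r + t' * r' + s"
        unfolding t(3) by (simp add: inner_add_left inner_add_right algebra_simps)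
    qed
    moreover have "K S = (\<Inter>(a, b, s) \<in> S. {(x, y, r). inner x b + inner a y \<le> r + s})"
      by (auto simp: K_def)
    ultimately show ?thesis
      by (auto intro!: convex_INT)
  qed
  have "lifted_graph A \<subseteq> K (lifted_graph A)"
  proof -
    have "inner x b + inner a y \<le> inner x y + inner a b" if "y \<in> A x" "b \<in> A a" for x y a b
      using monotone_operatorD[OF A that] by (simp add: inner_diff_left inner_diff_right)
    then show ?thesis by (auto simp: K_def lifted_graph_def)
  qed
  then have "convex hull lifted_graph A \<subseteq> K (lifted_graph A)"
    by (intro hull_minimal K)
  then have "lifted_graph A \<subseteq> K (convex hull lifted_graph A)"
    unfolding K_def by (fastforce simp: inner_commute)
  then have "convex hull lifted_graph A \<subseteq> K (convex hull lifted_graph A)"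
    by (intro hull_minimal K)
  then show ?thesis
    using X unfolding K_def by fastforce
qed

text \<open>
  Minty's theorem. With \<open>y = 2x - z\<close>, being monotonically related to \<open>(a, b)\<close> reads
  \<open>\<parallel>y - (a - b)\<parallel> \<le> \<parallel>a + b - z\<parallel>\<close> for the pair \<open>(x, z - x)\<close>, so a common point of these balls is needed.
  The function \<open>\<phi>\<close> below equals \<open>\<parallel>a + b - z\<parallel>\<^sup>2\<close> on the lifted graph, is nonnegative on its convex hull
  by the previous lemma, and is convex with modulus \<open>\<parallel>p X - p Y\<parallel>\<^sup>2\<close>, where \<open>p\<close> is the map
  \<open>(a, b, r) \<mapsto> a - b\<close>. Hence \<open>p\<close> is Cauchy along minimising sequences, and the limit \<open>y\<close> works: moving
  from a near-minimiser a little towards a point of the graph cannot push \<open>\<phi>\<close> below its infimum.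
\<close>

theorem minty_surjective:
  fixes A :: "'a::{real_inner, complete_space} \<Rightarrow> 'a set"
  assumes A: "maximally_monotone A"
  shows "\<exists>x. z - x \<in> A x"
proof -
  define S where "S = convex hull lifted_graph A"
  define \<phi> where "\<phi> = (\<lambda>(a, b, r). 4 * r - 2 * inner (a + b) z + (norm z)\<^sup>2 + (norm (a - b))\<^sup>2)"
  define p where "p = (\<lambda>(a::'a, b::'a, r::real). a - b)"
  have mono: "monotone_operator A"
    using A by (rule maximally_monotone_imp_monotone)
  have "\<exists>a b. b \<in> A a"
  proof (rule ccontr)
    assume "\<nexists>a b. b \<in> A a"
    then show False using maximally_monotoneD[OF A, of 0 0] by blast
  qed
  then have S_ne: "S \<noteq> {}"
    by (auto simp: S_def lifted_graph_def)
  have \<phi>_nonneg: "0 \<le> \<phi> X" if "X \<in> S" for X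
  proof (cases X)
    case (fields a b r)
    have "inner a b \<le> r"
      using that lifted_graph_hull[OF mono] by (simp add: S_def fields)
    moreover have "4 * inner a b - 2 * inner (a + b) z + (norm z)\<^sup>2 + (norm (a - b))\<^sup>2 = (norm (a + b - z))\<^sup>2"
      unfolding power2_norm_eq_inner
      by (simp add: inner_add_left inner_add_right inner_diff_left inner_diff_right inner_commute algebra_simps)
    moreover have "0 \<le> (norm (a + b - z))\<^sup>2" by simp
    ultimately have "0 \<le> 4 * r - 2 * inner (a + b) z + (norm z)\<^sup>2 + (norm (a - b))\<^sup>2"
      by linarith
    then show ?thesis by (simp add: \<phi>_def fields)
  qed
  have \<phi>_graph: "\<phi> (a, b, inner a b) = (norm (a + b - z))\<^sup>2" for a b
    unfolding power2_norm_eq_inner \<phi>_def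
    by (simp add: power2_norm_eq_inner inner_add_left inner_add_right inner_diff_left inner_diff_right inner_commute algebra_simps)
  have \<phi>_convex: "\<phi> ((1 - t) *\<^sub>R X + t *\<^sub>R Y) = (1 - t) * \<phi> X + t * \<phi> Y - t * (1 - t) * (norm (p X - p Y))\<^sup>2"
    for X Y t
  proof -
    obtain a b r a' b' r' where XY: "X = (a, b, r)" "Y = (a', b', r')"
      by (metis prod_cases3)
    have sq: "(norm ((1 - t) *\<^sub>R v + t *\<^sub>R v'))\<^sup>2 = (1 - t) * (norm v)\<^sup>2 + t * (norm v')\<^sup>2 - t * (1 - t) * (norm (v - v'))\<^sup>2"
      for v v' :: 'a
      unfolding power2_norm_eq_inner
      by (simp add: inner_add_left inner_add_right inner_diff_left inner_diff_right inner_commute algebra_simps)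
    have diff: "(1 - t) *\<^sub>R a + t *\<^sub>R a' - ((1 - t) *\<^sub>R b + t *\<^sub>R b') = (1 - t) *\<^sub>R (a - b) + t *\<^sub>R (a' - b')"
      by (simp add: algebra_simps)
    show ?thesis
      unfolding XY \<phi>_def p_def
      by (simp add: diff sq) (simp add: inner_add_left algebra_simps)
  qed
  define I where "I = Inf (\<phi> ` S)"
  have bdd: "bdd_below (\<phi> ` S)"
    by (rule bdd_belowI2[of _ 0]) (rule \<phi>_nonneg)
  have I_le: "I \<le> \<phi> X" if "X \<in> S" for X
    unfolding I_def using bdd that by (rule cINF_lower)
  have I_nonneg: "0 \<le> I"
    unfolding I_def using S_ne \<phi>_nonneg by (rule cINF_greatest)
  have gap: "I \<le> (1 - t) * \<phi> X + t * \<phi> Y - t * (1 - t) * (norm (p X - p Y))\<^sup>2"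
    if "X \<in> S" "Y \<in> S" "0 \<le> t" "t \<le> 1" for X Y t
  proof -
    have "(1 - t) *\<^sub>R X + t *\<^sub>R Y \<in> S"
      using that convex_convex_hull[of "lifted_graph A"] unfolding S_def convex_alt by blast
    then show ?thesis
      using I_le \<phi>_convex by metis
  qed
  have "\<exists>X\<in>S. \<phi> X < I + inverse (real (Suc n))" for n
    unfolding I_def using cInf_lessD[of "\<phi> ` S" "Inf (\<phi> ` S) + inverse (real (Suc n))"] S_ne by auto
  then obtain X where X: "\<And>n. X n \<in> S" "\<And>n. \<phi> (X n) < I + inverse (real (Suc n))"
    by metis
  have "Cauchy (\<lambda>n. p (X n))"
  proof (rule metric_CauchyI)
    fix \<epsilon> :: real assume \<epsilon>: "0 < \<epsilon>"
    obtain N where N: "inverse (real (Suc N)) < \<epsilon>\<^sup>2 / 4"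
      using reals_Archimedean[of "\<epsilon>\<^sup>2 / 4"] \<epsilon> by auto
    have "dist (p (X m)) (p (X n)) < \<epsilon>" if "m \<ge> N" "n \<ge> N" for m n
    proof -
      have "inverse (real (Suc m)) \<le> inverse (real (Suc N))" "inverse (real (Suc n)) \<le> inverse (real (Suc N))"
        using that by (auto intro!: le_imp_inverse_le)
      moreover have "I \<le> \<phi> (X m) / 2 + \<phi> (X n) / 2 - (norm (p (X m) - p (X n)))\<^sup>2 / 4"
        using gap[OF X(1) X(1), of "1/2" m n] by simp
      ultimately have "(norm (p (X m) - p (X n)))\<^sup>2 < \<epsilon>\<^sup>2"
        using X(2)[of m] X(2)[of n] N by linarith
      then show ?thesis
        using \<epsilon> by (simp add: dist_norm power2_less_imp_less)
    qed
    then show "\<exists>M. \<forall>m\<ge>M. \<forall>n\<ge>M. dist (p (X m)) (p (X n)) < \<epsilon>" by blast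
  qed
  then obtain y where y: "(\<lambda>n. p (X n)) \<longlonglongrightarrow> y"
    using Cauchy_convergent_iff convergent_def by blast
  have \<phi>_lim: "(\<lambda>n. \<phi> (X n)) \<longlonglongrightarrow> I"
  proof (rule tendsto_sandwich)
    show "\<forall>\<^sub>F n in sequentially. I \<le> \<phi> (X n)" using I_le X(1) by simp
    show "\<forall>\<^sub>F n in sequentially. \<phi> (X n) \<le> I + inverse (real (Suc n))"
      using X(2) by (simp add: less_imp_le)
    show "(\<lambda>n. I + inverse (real (Suc n))) \<longlonglongrightarrow> I"
      using tendsto_add[OF tendsto_const LIMSEQ_inverse_real_of_nat, of I] by simp
  qed simp
  have ball: "norm (y - (a - b)) \<le> norm (a + b - z)" if "b \<in> A a" for a b
  proof -
    define Y where "Y = (a, b, inner a b)"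
    have Y: "Y \<in> S" using that by (auto simp: S_def Y_def lifted_graph_def intro!: hull_inc)
    \<comment> \<open>The first-order condition at the (possibly not attained) infimum, before letting \<open>t\<close> tend to 0.\<close>
    have le: "(1 - t) * (norm (y - p Y))\<^sup>2 \<le> \<phi> Y - I" if t: "0 < t" "t \<le> 1" for t
    proof -
      have "(\<lambda>n. (1 - t) * \<phi> (X n) + t * \<phi> Y - t * (1 - t) * (norm (p (X n) - p Y))\<^sup>2)
          \<longlonglongrightarrow> (1 - t) * I + t * \<phi> Y - t * (1 - t) * (norm (y - p Y))\<^sup>2"
        by (intro tendsto_intros \<phi>_lim y)
      then have "I \<le> (1 - t) * I + t * \<phi> Y - t * (1 - t) * (norm (y - p Y))\<^sup>2"
      proof (rule tendsto_lowerbound)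
        show "\<forall>\<^sub>F n in sequentially. I \<le> (1 - t) * \<phi> (X n) + t * \<phi> Y - t * (1 - t) * (norm (p (X n) - p Y))\<^sup>2"
          using gap[OF X(1) Y] t by (intro always_eventually allI) simp
      qed simp
      then have "0 \<le> t * (\<phi> Y - I - (1 - t) * (norm (y - p Y))\<^sup>2)"
        by (simp add: algebra_simps)
      then show ?thesis using t by (simp add: zero_le_mult_iff)
    qed
    have "(norm (y - p Y))\<^sup>2 \<le> \<phi> Y - I"
    proof (rule tendsto_upperbound[where F = "at_right (0::real)"])
      show "((\<lambda>t. (1 - t) * (norm (y - p Y))\<^sup>2) \<longlongrightarrow> (norm (y - p Y))\<^sup>2) (at_right 0)"
        by (auto intro!: tendsto_eq_intros)
      show "\<forall>\<^sub>F t in at_right 0. (1 - t) * (norm (y - p Y))\<^sup>2 \<le> \<phi> Y - I"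
        using le by (intro eventually_at_rightI[of 0 1]) auto
    qed simp
    also have "\<dots> \<le> (norm (a + b - z))\<^sup>2"
      using I_nonneg \<phi>_graph[of a b] by (simp add: Y_def)
    finally have "(norm (y - p Y))\<^sup>2 \<le> (norm (a + b - z))\<^sup>2" .
    moreover have "p Y = a - b"
      by (simp add: Y_def p_def)
    ultimately show ?thesis
      by (metis norm_ge_zero power2_le_imp_le)
  qed
  define x where "x = (1/2) *\<^sub>R (y + z)"
  have "z - x \<in> A x"
  proof (rule maximally_monotoneD[OF A])
    fix a b assume "b \<in> A a"
    from ball[OF this] have le: "(norm (y - (a - b)))\<^sup>2 \<le> (norm (a + b - z))\<^sup>2"
      by (rule power_mono) simp
    have "4 * inner (x - a) (z - x - b) = (norm (a + b - z))\<^sup>2 - (norm (y - (a - b)))\<^sup>2"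
      unfolding power2_norm_eq_inner x_def
      by (simp add: inner_add_left inner_add_right inner_diff_left inner_diff_right inner_commute algebra_simps)
    then show "0 \<le> inner (x - a) (z - x - b)" using le by linarith
  qed
  then show ?thesis by blast
qed

lemma resolvent_in_graph:
  fixes A :: "'a::{real_inner, complete_space} \<Rightarrow> 'a set"
  assumes A: "maximally_monotone A" and c: "c > 0"
  shows "(z - resolvent (scale_operator c A) z) /\<^sub>R c \<in> A (resolvent (scale_operator c A) z)"
proof -
  let ?B = "scale_operator c A"
  have B: "maximally_monotone ?B"
    using A c by (rule maximally_monotone_scale)
  have mem: "y \<in> resolvent_set ?B z \<longleftrightarrow> z - y \<in> ?B y" for y
    unfolding resolvent_set_def inverse_operator_def Id_plus_def
    by (auto simp: image_iff algebra_simps intro: bexI[of _ "z - y"])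
  obtain y where y: "z - y \<in> ?B y"
    using minty_surjective[OF B] by blast
  have "y' = y" if "z - y' \<in> ?B y'" for y'
  proof -
    have "0 \<le> inner (y' - y) (z - y' - (z - y))"
      using monotone_operatorD[OF maximally_monotone_imp_monotone[OF B] that y] .
    also have "z - y' - (z - y) = - (y' - y)" by simp
    finally have "inner (y' - y) (y' - y) \<le> 0" by (simp only: inner_minus_right)
    then show ?thesis by (metis eq_iff_diff_eq_0 inner_eq_zero_iff inner_ge_zero order_antisym)
  qed
  then have "resolvent_set ?B z = {y}"
    using mem y by blast
  then have "resolvent ?B z = y"
    by (simp add: resolvent_def)
  moreover obtain w where "w \<in> A y" "z - y = c *\<^sub>R w"
    using y by (auto simp: scale_operator_def)
  ultimately show ?thesis using c by simp
qed

text \<open>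
  By polarisation, \<open>\<parallel>z - p\<parallel>\<^sup>2 - \<parallel>2y - z - p\<parallel>\<^sup>2 = 4\<langle>y - p, z - y\<rangle>\<close> for \<open>y = J z\<close>, which is nonnegative by
  monotonicity at \<open>y\<close> and the zero \<open>p\<close>.
\<close>

lemma reflected_resolvent_quasi_nonexpansive:
  fixes A :: "'a::{real_inner, complete_space} \<Rightarrow> 'a set"
  assumes A: "maximally_monotone A" and c: "c > 0" and p: "p \<in> zer A"
  shows "norm (2 *\<^sub>R resolvent (scale_operator c A) z - z - p) \<le> norm (z - p)"
proof -
  define y where "y = resolvent (scale_operator c A) z"
  have "0 \<le> inner (y - p) ((z - y) /\<^sub>R c - 0)"
    using p resolvent_in_graph[OF A c, of z]
    by (intro monotone_operatorD[OF maximally_monotone_imp_monotone[OF A]]) (auto simp: y_def zer_def)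
  then have "0 \<le> inner (y - p) (z - y)"
    using c by (simp add: zero_le_mult_iff)
  moreover have "4 * inner (y - p) (z - y) = (norm (z - p))\<^sup>2 - (norm (2 *\<^sub>R y - z - p))\<^sup>2"
    unfolding power2_norm_eq_inner
    by (simp add: inner_diff_left inner_diff_right inner_commute algebra_simps)
  ultimately have "(norm (2 *\<^sub>R y - z - p))\<^sup>2 \<le> (norm (z - p))\<^sup>2"
    by linarith
  then show ?thesis
    unfolding y_def[symmetric] by (rule power2_le_imp_le) simp
qed

section \<open>Zeros from bounded iterations\<close>

text \<open>
  The hypothesis says that \<open>z\<^sub>n\<close> is the resolvent of \<open>(n + 1) A\<close> at the origin, so these are approximate
  zeros as soon as they stay bounded. Monotonicity yields \<open>\<langle>z\<^sub>m - z\<^sub>n, z\<^sub>n\<rangle> \<ge> 0\<close> for \<open>n \<le> m\<close>, hence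
  \<open>\<parallel>z\<^sub>m - z\<^sub>n\<parallel>\<^sup>2 \<le> \<parallel>z\<^sub>m\<parallel>\<^sup>2 - \<parallel>z\<^sub>n\<parallel>\<^sup>2\<close>: the norms increase, so they converge, and this makes \<open>z\<close> itself
  Cauchy. Strong convergence avoids any appeal to weak compactness, and the limit is a zero because
  the graph is closed.
\<close>

lemma zer_nonempty_if_bounded_approximants:
  fixes A :: "'a::{real_inner, complete_space} \<Rightarrow> 'a set"
  assumes A: "maximally_monotone A"
    and z: "\<And>n. - (z n /\<^sub>R real (Suc n)) \<in> A (z n)"
    and bdd: "Bseq z"
  shows "zer A \<noteq> {}"
proof -
  have mono: "monotone_operator A"
    using A by (rule maximally_monotone_imp_monotone)
  have step: "(norm (z m - z n))\<^sup>2 \<le> (norm (z m))\<^sup>2 - (norm (z n))\<^sup>2" if mn: "n \<le> m" for m n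
  proof -
    define t where "t = real (Suc n) / real (Suc m)"
    have t: "0 < t" "t \<le> 1" using mn by (auto simp: t_def field_simps)
    have "0 \<le> real (Suc n) * inner (z m - z n) (- (z m /\<^sub>R real (Suc m)) - (- (z n /\<^sub>R real (Suc n))))"
      using monotone_operatorD[OF mono z z, of m n] by simp
    also have "\<dots> = inner (z m - z n) (real (Suc n) *\<^sub>R (- (z m /\<^sub>R real (Suc m)) - (- (z n /\<^sub>R real (Suc n)))))"
      by (simp only: inner_scaleR_right)
    also have "real (Suc n) *\<^sub>R (- (z m /\<^sub>R real (Suc m)) - (- (z n /\<^sub>R real (Suc n)))) = z n - t *\<^sub>R z m"
      by (simp add: scaleR_right_diff_distrib t_def divide_inverse del: of_nat_Suc)
    finally have ge: "0 \<le> inner (z m - z n) (z n - t *\<^sub>R z m)" .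
    have "inner (z m - z n) (z n - t *\<^sub>R z m) = (1 - t) * inner (z m - z n) (z n) - t * (norm (z m - z n))\<^sup>2"
      unfolding power2_norm_eq_inner
      by (simp add: inner_diff_left inner_diff_right inner_commute algebra_simps)
    with ge have le: "t * (norm (z m - z n))\<^sup>2 \<le> (1 - t) * inner (z m - z n) (z n)"
      by linarith
    moreover have "0 \<le> t * (norm (z m - z n))\<^sup>2" using t by simp
    ultimately have ge': "0 \<le> (1 - t) * inner (z m - z n) (z n)" by linarith
    have "0 \<le> inner (z m - z n) (z n)"
    proof (cases "t = 1")
      case True
      with le t show ?thesis by simp
    next
      case False
      with ge' t show ?thesis by (simp add: zero_le_mult_iff)
    qed
    then show ?thesis
      unfolding power2_norm_eq_inner
      by (simp add: inner_diff_left inner_diff_right inner_commute algebra_simps)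
  qed
  define q where "q n = (norm (z n))\<^sup>2" for n
  have "incseq q"
    unfolding incseq_def q_def
  proof (intro allI impI)
    fix n m :: nat assume "n \<le> m"
    from step[OF this] zero_le_power2[of "norm (z m - z n)"]
    show "(norm (z n))\<^sup>2 \<le> (norm (z m))\<^sup>2" by linarith
  qed
  moreover obtain K where "\<And>n. norm (z n) \<le> K" using bdd by (metis BseqE)
  then have "\<And>n. q n \<le> K\<^sup>2" by (simp add: q_def power_mono)
  ultimately have "convergent q"
    using incseq_convergent[of q "K\<^sup>2"] by (metis convergentI)
  then have "Cauchy q" by (rule convergent_Cauchy)
  have "Cauchy z"
  proof (rule metric_CauchyI)
    fix \<epsilon> :: real assume \<epsilon>: "0 < \<epsilon>"
    obtain N where N: "\<And>m n. m \<ge> N \<Longrightarrow> n \<ge> N \<Longrightarrow> dist (q m) (q n) < \<epsilon>\<^sup>2"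
      using metric_CauchyD[OF \<open>Cauchy q\<close>, of "\<epsilon>\<^sup>2"] \<epsilon> by auto
    have less: "dist (z m) (z n) < \<epsilon>" if "N \<le> n" "n \<le> m" for m n
    proof (rule power2_less_imp_less)
      show "(dist (z m) (z n))\<^sup>2 < \<epsilon>\<^sup>2"
        using step[OF that(2)] N[of m n] that by (simp add: dist_norm q_def)
    qed (use \<epsilon> in simp)
    show "\<exists>M. \<forall>m\<ge>M. \<forall>n\<ge>M. dist (z m) (z n) < \<epsilon>"
    proof (intro exI allI impI)
      fix m n assume "N \<le> m" "N \<le> n"
      then show "dist (z m) (z n) < \<epsilon>"
        using less[of n m] less[of m n] by (cases "n \<le> m") (auto simp: dist_commute)
    qed
  qed
  then obtain l where l: "z \<longlonglongrightarrow> l"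
    using Cauchy_convergent_iff convergent_def by blast
  have w: "(\<lambda>n. - (z n /\<^sub>R real (Suc n))) \<longlonglongrightarrow> 0"
    using tendsto_minus[OF tendsto_scaleR[OF LIMSEQ_inverse_real_of_nat l]] by simp
  have "0 \<in> A l"
  proof (rule maximally_monotoneD[OF A])
    fix a b assume b: "b \<in> A a"
    have "(\<lambda>n. inner (z n - a) (- (z n /\<^sub>R real (Suc n)) - b)) \<longlonglongrightarrow> inner (l - a) (0 - b)"
      by (intro tendsto_intros l w)
    then show "0 \<le> inner (l - a) (0 - b)"
      by (rule tendsto_lowerbound) (use monotone_operatorD[OF mono z b] in auto)
  qed
  then show ?thesis by (auto simp: zer_def)
qed

text \<open>
  The descent argument. The expansion of \<open>\<parallel>x\<^sub>k - a - \<gamma>\<^sub>k c\<^sub>k w\<^sub>k\<parallel>\<^sup>2\<close> contains the term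
  \<open>- \<gamma>\<^sub>k (2 - \<gamma>\<^sub>k) c\<^sub>k\<^sup>2 \<parallel>w\<^sub>k\<parallel>\<^sup>2\<close>, which can be dropped when \<open>0 \<le> \<gamma>\<^sub>k \<le> 2\<close>, and
  \<open>- 2 \<gamma>\<^sub>k c\<^sub>k \<langle>y\<^sub>k - a, w\<^sub>k\<rangle>\<close>, where monotonicity allows replacing \<open>w\<^sub>k\<close> by \<open>b\<close>. If
  \<open>\<langle>y\<^sub>k - a, b\<rangle> \<ge> \<eta>\<close> held eventually, then \<open>\<parallel>x\<^sub>k - a\<parallel>\<^sup>2\<close> would drop by at least \<open>g m \<eta>\<close> in every late
  step: the factor 2 leaves a surplus of \<open>g m \<eta>\<close> that swallows the vanishing error.
\<close>

lemma frequently_inner_less: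
  fixes x y w \<epsilon> :: "nat \<Rightarrow> 'a::real_inner" and c \<gamma> :: "nat \<Rightarrow> real"
  assumes A: "monotone_operator A" and ab: "b \<in> A a"
    and w: "\<And>k. w k \<in> A (y k)" and x: "\<And>k. x k = y k + c k *\<^sub>R w k"
    and step: "\<And>k. x (Suc k) = x k - (\<gamma> k * c k) *\<^sub>R w k + \<epsilon> k"
    and \<epsilon>: "\<epsilon> \<longlonglongrightarrow> 0" and bdd: "Bseq x"
    and g: "0 < g" "\<forall>\<^sub>F k in sequentially. g \<le> \<gamma> k \<and> \<gamma> k \<le> 2"
    and m: "0 < m" "\<forall>\<^sub>F k in sequentially. m \<le> c k"
    and \<eta>: "0 < \<eta>"
  shows "\<exists>\<^sub>F k in sequentially. inner (y k - a) b < \<eta>"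
  unfolding frequently_def
proof
  assume "\<forall>\<^sub>F k in sequentially. \<not> inner (y k - a) b < \<eta>"
  then have large: "\<forall>\<^sub>F k in sequentially. \<eta> \<le> inner (y k - a) b"
    by (simp add: not_less)
  define err where "err k = (2 * norm (x (Suc k) - a) + norm (\<epsilon> k)) * norm (\<epsilon> k)" for k
  obtain K where K: "\<And>k. norm (x k) \<le> K" using bdd by (metis BseqE)
  have descent: "(norm (x (Suc k) - a))\<^sup>2 \<le> (norm (x k - a))\<^sup>2 - 2 * (\<gamma> k * c k) * inner (y k - a) b + err k"
    if \<gamma>: "0 \<le> \<gamma> k" "\<gamma> k \<le> 2" and c: "0 \<le> c k" for k
  proof -
    define v where "v = x k - a - (\<gamma> k * c k) *\<^sub>R w k"
    have next_x: "x (Suc k) - a = v + \<epsilon> k" by (simp add: v_def step)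
    have "0 \<le> inner (y k - a) (w k - b)"
      using A w ab by (rule monotone_operatorD)
    then have "(\<gamma> k * c k) * inner (y k - a) b \<le> (\<gamma> k * c k) * inner (y k - a) (w k)"
      using \<gamma> c by (intro mult_left_mono) (auto simp: inner_diff_right)
    moreover have "(norm v)\<^sup>2 = (norm (x k - a))\<^sup>2 - 2 * ((\<gamma> k * c k) * inner (y k - a) (w k))
        - (2 - \<gamma> k) * \<gamma> k * (c k)\<^sup>2 * (norm (w k))\<^sup>2"
      unfolding power2_norm_eq_inner v_def x
      by (simp add: inner_add_left inner_add_right inner_diff_left inner_diff_right inner_commute
          power2_eq_square algebra_simps)
    moreover have "0 \<le> (2 - \<gamma> k) * \<gamma> k * (c k)\<^sup>2 * (norm (w k))\<^sup>2"
      using \<gamma> by simp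
    moreover have "(norm (x (Suc k) - a))\<^sup>2 \<le> (norm v)\<^sup>2 + err k"
    proof -
      have "(norm (x (Suc k) - a))\<^sup>2 = (norm v)\<^sup>2 + inner (2 *\<^sub>R (x (Suc k) - a) - \<epsilon> k) (\<epsilon> k)"
        unfolding power2_norm_eq_inner next_x
        by (simp add: inner_add_left inner_add_right inner_diff_left inner_commute algebra_simps)
      also have "inner (2 *\<^sub>R (x (Suc k) - a) - \<epsilon> k) (\<epsilon> k) \<le> norm (2 *\<^sub>R (x (Suc k) - a) - \<epsilon> k) * norm (\<epsilon> k)"
        by (rule norm_cauchy_schwarz)
      also have "\<dots> \<le> err k"
        unfolding err_def by (intro mult_right_mono order_trans[OF norm_triangle_ineq4]) auto
      finally show ?thesis by simp
    qed
    ultimately show ?thesis by linarith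
  qed
  have "err \<longlonglongrightarrow> 0"
  proof (rule Lim_null_comparison)
    show "\<forall>\<^sub>F k in sequentially. norm (err k) \<le> (2 * (K + norm a) + norm (\<epsilon> k)) * norm (\<epsilon> k)"
    proof (intro always_eventually allI)
      fix k
      have "norm (x (Suc k) - a) \<le> K + norm a"
        using norm_triangle_ineq4[of "x (Suc k)" a] K[of "Suc k"] by linarith
      then show "norm (err k) \<le> (2 * (K + norm a) + norm (\<epsilon> k)) * norm (\<epsilon> k)"
        by (simp add: err_def mult_right_mono)
    qed
    show "(\<lambda>k. (2 * (K + norm a) + norm (\<epsilon> k)) * norm (\<epsilon> k)) \<longlonglongrightarrow> 0"
      by (rule tendsto_eq_intros tendsto_norm[OF \<epsilon>] refl | simp)+
  qed
  moreover have pos: "0 < g * m * \<eta>" using g m \<eta> by simp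
  ultimately have "\<forall>\<^sub>F k in sequentially. err k < g * m * \<eta>"
    by (rule order_tendstoD)
  with g(2) m(2) large have
    "\<forall>\<^sub>F k in sequentially. (norm (x (Suc k) - a))\<^sup>2 \<le> (norm (x k - a))\<^sup>2 - g * m * \<eta>"
  proof eventually_elim
    case (elim k)
    have "g * m * \<eta> \<le> \<gamma> k * c k * inner (y k - a) b"
      using elim g m \<eta> by (intro mult_mono) auto
    moreover have "(norm (x (Suc k) - a))\<^sup>2 \<le> (norm (x k - a))\<^sup>2 - 2 * (\<gamma> k * c k) * inner (y k - a) b + err k"
      using elim g m by (intro descent) auto
    ultimately show ?case using elim by linarith
  qed
  then obtain N where N: "\<And>k. N \<le> k \<Longrightarrow> (norm (x (Suc k) - a))\<^sup>2 \<le> (norm (x k - a))\<^sup>2 - g * m * \<eta>"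
    by (auto simp: eventually_sequentially)
  have decay: "(norm (x (N + n) - a))\<^sup>2 \<le> (norm (x N - a))\<^sup>2 - real n * (g * m * \<eta>)" for n
  proof (induction n)
    case (Suc n)
    then show ?case using N[of "N + n"] by (simp add: algebra_simps)
  qed simp
  obtain n where "(norm (x N - a))\<^sup>2 < real n * (g * m * \<eta>)"
    using reals_Archimedean3[OF pos] by blast
  with decay[of n] zero_le_power2[of "norm (x (N + n) - a)"] show False by linarith
qed

text \<open>
  The previous lemma is applied with \<open>a = z\<^sub>n\<close> and \<open>b = - z\<^sub>n/(n + 1)\<close>. If \<open>\<parallel>y\<^sub>k\<parallel> \<le> Y\<close> eventually, then
  \<open>\<langle>y\<^sub>k - z\<^sub>n, b\<rangle>\<close> is at least \<open>(\<parallel>z\<^sub>n\<parallel> - Y) \<parallel>z\<^sub>n\<parallel> / (n + 1)\<close>, which would be a positive lower bound if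
  \<open>\<parallel>z\<^sub>n\<parallel> > Y\<close>. So \<open>Y\<close> bounds the sequence \<open>z\<close>.
\<close>

lemma zer_nonempty_if_bounded_iteration:
  fixes A :: "'a::{real_inner, complete_space} \<Rightarrow> 'a set"
    and c \<alpha> \<beta> \<gamma> \<delta> :: "nat \<Rightarrow> real"
  assumes A: "maximally_monotone A" and c: "\<And>k. c k > 0"
    and iter: "\<And>k. x (Suc k) =
        \<alpha> k *\<^sub>R u + \<beta> k *\<^sub>R x k + \<gamma> k *\<^sub>R resolvent (scale_operator (c k) A) (x k) + \<delta> k *\<^sub>R e k"
    and \<alpha>: "\<alpha> \<longlonglongrightarrow> 0" and \<beta>\<gamma>: "(\<lambda>k. \<beta> k + \<gamma> k) \<longlonglongrightarrow> 1" and \<delta>e: "(\<lambda>k. \<delta> k *\<^sub>R e k) \<longlonglongrightarrow> 0"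
    and g: "0 < g" "\<forall>\<^sub>F k in sequentially. g \<le> \<gamma> k \<and> \<gamma> k \<le> 2"
    and m: "0 < m" "\<forall>\<^sub>F k in sequentially. m \<le> c k"
    and bdd: "Bseq x"
  shows "zer A \<noteq> {}"
proof -
  define y where "y k = resolvent (scale_operator (c k) A) (x k)" for k
  define w where "w k = (x k - y k) /\<^sub>R c k" for k
  define \<epsilon> where "\<epsilon> k = \<alpha> k *\<^sub>R u + (\<beta> k + \<gamma> k - 1) *\<^sub>R x k + \<delta> k *\<^sub>R e k" for k
  have w: "w k \<in> A (y k)" for k
    unfolding w_def y_def using A c by (rule resolvent_in_graph)
  have cw: "c k *\<^sub>R w k = x k - y k" for k
    using c[of k] by (simp add: w_def)
  have step: "x (Suc k) = x k - \<gamma> k *\<^sub>R (x k - y k) + \<epsilon> k" for k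
    unfolding iter y_def \<epsilon>_def by (simp add: algebra_simps)
  have step': "x (Suc k) = x k - (\<gamma> k * c k) *\<^sub>R w k + \<epsilon> k" for k
    using step[of k] cw[of k] by (simp flip: scaleR_scaleR)
  have "(\<lambda>k. (\<beta> k + \<gamma> k - 1) *\<^sub>R x k) \<longlonglongrightarrow> 0"
    using \<beta>\<gamma> bdd by (simp add: tendsto_Zfun_iff bounded_bilinear.Zfun_prod_Bfun[OF bounded_bilinear_scaleR] LIM_zero)
  moreover have "(\<lambda>k. \<alpha> k *\<^sub>R u) \<longlonglongrightarrow> 0"
    using tendsto_scaleR[OF \<alpha> tendsto_const[of u]] by simp
  ultimately have "(\<lambda>k. \<alpha> k *\<^sub>R u + (\<beta> k + \<gamma> k - 1) *\<^sub>R x k + \<delta> k *\<^sub>R e k) \<longlonglongrightarrow> 0 + 0 + 0"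
    by (intro tendsto_add \<delta>e)
  then have \<epsilon>: "\<epsilon> \<longlonglongrightarrow> 0"
    by (simp add: \<epsilon>_def[abs_def])
  obtain K where K: "0 < K" "\<And>k. norm (x k) \<le> K" using bdd by (metis BseqE)
  have "\<forall>\<^sub>F k in sequentially. norm (\<epsilon> k) < 1"
    using tendsto_norm[OF \<epsilon>] by (rule order_tendstoD) simp
  with g(2) have y_le: "\<forall>\<^sub>F k in sequentially. norm (y k) \<le> K + (2 * K + 1) / g"
  proof eventually_elim
    case (elim k)
    have "g * norm (y k - x k) \<le> \<gamma> k * norm (y k - x k)"
      using elim by (intro mult_right_mono) auto
    also have "\<dots> = norm (\<gamma> k *\<^sub>R (y k - x k))"
      using elim g by simp
    also have "\<gamma> k *\<^sub>R (y k - x k) = x (Suc k) - x k - \<epsilon> k"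
      unfolding step by (simp add: algebra_simps)
    also have "norm (x (Suc k) - x k - \<epsilon> k) \<le> norm (x (Suc k)) + norm (x k) + norm (\<epsilon> k)"
      by (intro order_trans[OF norm_triangle_ineq4] add_right_mono norm_triangle_ineq4)
    also have "\<dots> \<le> 2 * K + 1"
      using elim K(2)[of k] K(2)[of "Suc k"] by linarith
    finally have "norm (y k - x k) \<le> (2 * K + 1) / g"
      using g by (simp add: field_simps)
    then show ?case
      using K(2)[of k] norm_triangle_sub[of "y k" "x k"] by linarith
  qed
  define Y where "Y = K + (2 * K + 1) / g"
  have "\<exists>z. - (z /\<^sub>R real (Suc n)) \<in> A z" for n
  proof -
    have "maximally_monotone (scale_operator (real (Suc n)) A)"
      using A by (rule maximally_monotone_scale) simp
    then obtain z where "0 - z \<in> scale_operator (real (Suc n)) A z"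
      using minty_surjective by blast
    then obtain v where v: "v \<in> A z" "- z = real (Suc n) *\<^sub>R v"
      by (auto simp: scale_operator_def)
    have "- (z /\<^sub>R real (Suc n)) = (- z) /\<^sub>R real (Suc n)" by simp
    also have "\<dots> = v" unfolding v(2) by (simp del: of_nat_Suc)
    finally show ?thesis using v(1) by metis
  qed
  then obtain z where z: "\<And>n. - (z n /\<^sub>R real (Suc n)) \<in> A (z n)"
    by metis
  have "norm (z n) \<le> Y" for n
  proof (rule ccontr)
    assume "\<not> norm (z n) \<le> Y"
    moreover have "0 < Y" using K g by (simp add: Y_def add_pos_pos)
    ultimately have \<eta>: "0 < (norm (z n) - Y) * norm (z n) / real (Suc n)"
      by (intro divide_pos_pos mult_pos_pos) auto
    have "\<exists>\<^sub>F k in sequentially. inner (y k - z n) (- (z n /\<^sub>R real (Suc n)))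
        < (norm (z n) - Y) * norm (z n) / real (Suc n)"
      by (rule frequently_inner_less[OF maximally_monotone_imp_monotone[OF A] z w _ step' \<epsilon> bdd g m \<eta>])
        (simp add: cw)
    from frequently_eventually_frequently[OF this y_le]
    obtain k where k: "norm (y k) \<le> Y"
      "inner (y k - z n) (- (z n /\<^sub>R real (Suc n))) < (norm (z n) - Y) * norm (z n) / real (Suc n)"
      by (auto simp: Y_def dest: frequently_ex)
    have "inner (y k - z n) (- (z n /\<^sub>R real (Suc n))) = ((norm (z n))\<^sup>2 - inner (y k) (z n)) / real (Suc n)"
      by (simp add: inner_diff_left power2_norm_eq_inner divide_inverse algebra_simps del: of_nat_Suc)
    with k(2) have "(norm (z n))\<^sup>2 - inner (y k) (z n) < (norm (z n) - Y) * norm (z n)"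
      by (simp add: divide_less_cancel del: of_nat_Suc)
    moreover have "inner (y k) (z n) \<le> Y * norm (z n)"
      using norm_cauchy_schwarz[of "y k" "z n"] mult_right_mono[OF k(1) norm_ge_zero] by (rule order_trans)
    ultimately show False by (simp add: power2_eq_square algebra_simps)
  qed
  then have "Bseq z" by (rule BseqI')
  with A z show ?thesis by (rule zer_nonempty_if_bounded_approximants)
qed

section \<open>Boundedness in the presence of a zero\<close>

text \<open>
  A perturbation \<open>t\<close> is harmless for the recursion \<open>a\<^sub>k\<^sub>+\<^sub>1 \<le> \<rho>\<^sub>k a\<^sub>k + t\<^sub>k\<close> if, up to a summable part, it fits
  into the room \<open>1 - \<rho>\<^sub>k\<close> left by the contraction factor. This property is closed under sums, so the
  contributions of \<open>\<alpha>\<close>, \<open>\<delta>\<close> and the defect \<open>1 - \<beta> - \<gamma>\<close> can be treated separately.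
\<close>

definition absorbable :: "(nat \<Rightarrow> real) \<Rightarrow> (nat \<Rightarrow> real) \<Rightarrow> bool" where
  "absorbable \<rho> t \<longleftrightarrow>
     (\<exists>M s. summable s \<and> (\<forall>k. 0 \<le> s k) \<and> (\<forall>\<^sub>F k in sequentially. t k \<le> (1 - \<rho> k) * M + s k))"

lemma absorbable_add:
  assumes "absorbable \<rho> t" "absorbable \<rho> t'"
  shows "absorbable \<rho> (\<lambda>k. t k + t' k)"
proof -
  obtain M s where h: "summable s" "\<And>k. 0 \<le> s k" "\<forall>\<^sub>F k in sequentially. t k \<le> (1 - \<rho> k) * M + s k"
    using assms(1) unfolding absorbable_def by blast
  obtain M' s' where h': "summable s'" "\<And>k. 0 \<le> s' k"
    "\<forall>\<^sub>F k in sequentially. t' k \<le> (1 - \<rho> k) * M' + s' k"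
    using assms(2) unfolding absorbable_def by blast
  have "\<forall>\<^sub>F k in sequentially. t k + t' k \<le> (1 - \<rho> k) * (M + M') + (s k + s' k)"
    using h(3) h'(3) by eventually_elim (simp add: algebra_simps)
  then show ?thesis
    unfolding absorbable_def
    using h h' by (intro exI[of _ "M + M'"] exI[of _ "\<lambda>k. s k + s' k"] conjI summable_add) auto
qed

lemma absorbable_mono:
  assumes "absorbable \<rho> t'" "\<And>k. t k \<le> t' k"
  shows "absorbable \<rho> t"
proof -
  obtain M s where h: "summable s" "\<And>k. 0 \<le> s k" "\<forall>\<^sub>F k in sequentially. t' k \<le> (1 - \<rho> k) * M + s k"
    using assms(1) unfolding absorbable_def by blast
  have "\<forall>\<^sub>F k in sequentially. t k \<le> (1 - \<rho> k) * M + s k"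
    using h(3) by eventually_elim (rule order_trans[OF assms(2)])
  then show ?thesis unfolding absorbable_def using h by blast
qed

lemma absorbable_if_summable:
  assumes "summable s" "\<And>k. 0 \<le> s k"
  shows "absorbable \<rho> s"
  unfolding absorbable_def using assms by (intro exI[where x = "0::real"] exI[where x = s] conjI) auto

lemma absorbable_if_le_slack:
  assumes "\<forall>\<^sub>F k in sequentially. t k \<le> (1 - \<rho> k) * M"
  shows "absorbable \<rho> t"
  unfolding absorbable_def using assms by (intro exI[where x = M] exI[where x = "\<lambda>_. 0"]) auto

lemma absorbable_scaled:
  assumes "(\<forall>k. \<rho> k + \<bar>v k\<bar> \<le> 1) \<or> summable (\<lambda>k. \<bar>v k\<bar>)" and C: "0 \<le> C"
  shows "absorbable \<rho> (\<lambda>k. \<bar>v k\<bar> * C)"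
  using assms(1)
proof
  assume "\<forall>k. \<rho> k + \<bar>v k\<bar> \<le> 1"
  then have "\<bar>v k\<bar> * C \<le> (1 - \<rho> k) * C" for k
    using C by (intro mult_right_mono) (auto simp: algebra_simps)
  then show ?thesis by (intro absorbable_if_le_slack always_eventually) blast
next
  assume "summable (\<lambda>k. \<bar>v k\<bar>)"
  then show ?thesis using C by (intro absorbable_if_summable summable_mult2) auto
qed

text \<open>
  From some index \<open>N\<close> on, \<open>a\<^sub>k\<^sub>+\<^sub>1\<close> is at most a convex combination of \<open>a\<^sub>k\<close> and \<open>M\<close> plus \<open>s\<^sub>k\<close>, so \<open>a\<close>
  never exceeds \<open>max a\<^sub>N M\<close> by more than the sum of \<open>s\<close>.
\<close>

lemma perturbed_averaging_bounded:
  fixes a \<rho> t :: "nat \<Rightarrow> real"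
  assumes a: "\<And>k. 0 \<le> a k" and \<rho>: "\<And>k. 0 \<le> \<rho> k" "\<forall>\<^sub>F k in sequentially. \<rho> k \<le> 1"
    and step: "\<And>k. a (Suc k) \<le> \<rho> k * a k + t k"
    and t: "absorbable \<rho> t"
  shows "Bseq a"
proof -
  obtain M s where s: "summable s" "\<And>k. 0 \<le> s k" and le: "\<forall>\<^sub>F k in sequentially. t k \<le> (1 - \<rho> k) * M + s k"
    using t unfolding absorbable_def by blast
  obtain N where N: "\<And>k. N \<le> k \<Longrightarrow> \<rho> k \<le> 1" "\<And>k. N \<le> k \<Longrightarrow> t k \<le> (1 - \<rho> k) * M + s k"
    using eventually_conj[OF \<rho>(2) le] by (auto simp: eventually_sequentially)
  define C where "C = max (a N) M"
  have bound: "a (N + n) \<le> C + (\<Sum>i<N + n. s i)" for n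
  proof (induction n)
    case 0
    then show ?case using s(2) by (simp add: C_def sum_nonneg add_increasing2)
  next
    case (Suc n)
    let ?k = "N + n" and ?D = "C + (\<Sum>i<N + n. s i)"
    have "M \<le> ?D" using s(2) by (simp add: C_def sum_nonneg add_increasing2)
    have "a (Suc ?k) \<le> \<rho> ?k * a ?k + ((1 - \<rho> ?k) * M + s ?k)"
      using step[of ?k] N(2)[of ?k] by simp
    also have "\<dots> \<le> \<rho> ?k * ?D + ((1 - \<rho> ?k) * ?D + s ?k)"
      using Suc \<rho>(1)[of ?k] N(1)[of ?k] \<open>M \<le> ?D\<close> by (intro add_mono mult_left_mono) auto
    also have "\<dots> = C + (\<Sum>i<N + Suc n. s i)"
      by (simp add: algebra_simps)
    finally show ?case by simp
  qed
  have "norm (a k) \<le> C + suminf s" if "N \<le> k" for k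
    using bound[of "k - N"] sum_le_suminf[OF s(1), of "{..<k}"] a[of k] s(2) that by simp
  then show ?thesis
    by (intro BfunI) (auto simp: eventually_sequentially)
qed

text \<open>
  The step is regrouped as
  \<open>x\<^sub>k\<^sub>+\<^sub>1 - p = (\<beta>\<^sub>k + \<gamma>\<^sub>k/2)(x\<^sub>k - p) + (\<gamma>\<^sub>k/2)((2J - Id) x\<^sub>k - p) + r\<^sub>k\<close>, which is where the factor
  \<open>\<rho>\<^sub>k\<close> comes from.
\<close>

lemma iteration_bounded_if_residual_absorbable:
  fixes A :: "'a::{real_inner, complete_space} \<Rightarrow> 'a set"
    and c \<alpha> \<beta> \<gamma> \<delta> :: "nat \<Rightarrow> real"
  assumes A: "maximally_monotone A" and c: "\<And>k. c k > 0" and p: "p \<in> zer A"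
    and iter: "\<And>k. x (Suc k) =
        \<alpha> k *\<^sub>R u + \<beta> k *\<^sub>R x k + \<gamma> k *\<^sub>R resolvent (scale_operator (c k) A) (x k) + \<delta> k *\<^sub>R e k"
    and \<rho>: "\<And>k. \<rho> k = \<bar>\<beta> k + \<gamma> k / 2\<bar> + \<bar>\<gamma> k / 2\<bar>" "\<forall>\<^sub>F k in sequentially. \<rho> k \<le> 1"
    and r: "absorbable \<rho> (\<lambda>k. norm (\<alpha> k *\<^sub>R u + \<delta> k *\<^sub>R e k - (1 - \<beta> k - \<gamma> k) *\<^sub>R p))"
  shows "Bseq x"
proof -
  have "Bseq (\<lambda>k. norm (x k - p))"
  proof (rule perturbed_averaging_bounded[OF _ _ \<rho>(2) _ r])
    fix k
    define y where "y = resolvent (scale_operator (c k) A) (x k)"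
    let ?r = "\<alpha> k *\<^sub>R u + \<delta> k *\<^sub>R e k - (1 - \<beta> k - \<gamma> k) *\<^sub>R p"
    have y: "norm (2 *\<^sub>R y - x k - p) \<le> norm (x k - p)"
      unfolding y_def using A c p by (rule reflected_resolvent_quasi_nonexpansive)
    have "x (Suc k) - p = (\<beta> k + \<gamma> k / 2) *\<^sub>R (x k - p) + (\<gamma> k / 2) *\<^sub>R (2 *\<^sub>R y - x k - p) + ?r"
    proof -
      have "(\<beta> k + \<gamma> k / 2) *\<^sub>R (x k - p) + (\<gamma> k / 2) *\<^sub>R (2 *\<^sub>R y - x k - p) + ?r
        = \<alpha> k *\<^sub>R u + \<beta> k *\<^sub>R x k + \<gamma> k *\<^sub>R y + \<delta> k *\<^sub>R e k
          - (\<beta> k + \<gamma> k / 2 + \<gamma> k / 2 + (1 - \<beta> k - \<gamma> k)) *\<^sub>R p"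
        by (simp only: scaleR_left_distrib scaleR_left_diff_distrib scaleR_right_diff_distrib scaleR_scaleR) (simp add: algebra_simps)
      then show ?thesis by (simp add: iter y_def)
    qed
    then have "norm (x (Suc k) - p) \<le> norm ((\<beta> k + \<gamma> k / 2) *\<^sub>R (x k - p)) + norm ((\<gamma> k / 2) *\<^sub>R (2 *\<^sub>R y - x k - p)) + norm ?r"
      by (simp only:) (intro order_trans[OF norm_triangle_ineq] add_right_mono norm_triangle_ineq)
    also have "\<dots> \<le> \<bar>\<beta> k + \<gamma> k / 2\<bar> * norm (x k - p) + \<bar>\<gamma> k / 2\<bar> * norm (x k - p) + norm ?r"
      unfolding norm_scaleR using y by (intro add_mono mult_left_mono) auto
    finally show "norm (x (Suc k) - p) \<le> \<rho> k * norm (x k - p) + norm ?r"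
      by (simp add: \<rho>(1) algebra_simps)
  qed (auto simp: \<rho>(1))
  then obtain K where K: "\<And>k. norm (x k - p) \<le> K" by (auto simp: Bseq_def)
  have "norm (x k) \<le> norm p + K" for k
    using K[of k] norm_triangle_sub[of "x k" p] by linarith
  then show ?thesis by (rule BseqI')
qed

text \<open>
  Strict inequalities for extended-real limits superior and inferior give real bounds with a margin.
\<close>

lemma real_limsup_less_oneE:
  assumes "limsup (\<lambda>k. ereal (f k)) < 1"
  obtains q where "q < 1" "\<forall>\<^sub>F k in sequentially. f k < q"
proof -
  obtain q where "limsup (\<lambda>k. ereal (f k)) < ereal q" "ereal q < 1"
    using ereal_dense2[OF assms] by blast
  then show thesis
    using Limsup_lessD[of sequentially "\<lambda>k. ereal (f k)" "ereal q"] that by auto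
qed

lemma real_liminf_posE:
  assumes "0 < liminf (\<lambda>k. ereal (f k))"
  obtains q where "0 < q" "\<forall>\<^sub>F k in sequentially. q < f k"
proof -
  obtain q where "0 < ereal q" "ereal q < liminf (\<lambda>k. ereal (f k))"
    using ereal_dense2[OF assms] by blast
  then show thesis
    using less_LiminfD[of "ereal q" sequentially "\<lambda>k. ereal (f k)"] that by auto
qed

text \<open>
  In each alternative the residual is split differently, according to which sums of parameters are
  controlled: the vectors multiplied by \<open>\<alpha>\<close>, \<open>\<delta>\<close> and the remaining defect are \<open>u, e\<^sub>k, p\<close> when the
  defect is \<open>1 - \<beta> - \<gamma>\<close> (\<open>bound1\<close>), \<open>u - p, e\<^sub>k, p\<close> when it is \<open>1 - \<alpha> - \<beta> - \<gamma>\<close> (\<open>bound2\<close>), and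
  \<open>u, e\<^sub>k - p, p\<close> when it is \<open>1 - \<beta> - \<gamma> - \<delta>\<close> (\<open>bound3\<close>).
\<close>

lemma residual_absorbable:
  fixes u p :: "'a::real_normed_vector" and e :: "nat \<Rightarrow> 'a" and \<alpha> \<beta> \<gamma> \<delta> \<rho> :: "nat \<Rightarrow> real"
  assumes \<rho>: "\<And>k. \<rho> k = \<bar>\<beta> k + \<gamma> k / 2\<bar> + \<bar>\<gamma> k / 2\<bar>"
    and cases:
      "(limsup (\<lambda>k. ereal (\<rho> k)) < 1 \<and>
        bdd_above (range (\<lambda>k. \<bar>\<alpha> k\<bar>)) \<and>
        bdd_above (range (\<lambda>k. norm (\<delta> k *\<^sub>R e k))))
     \<or> ((\<forall>k. \<rho> k \<le> 1) \<and>
        ((\<forall>k. \<rho> k + \<bar>\<alpha> k\<bar> \<le> 1) \<or> summable (\<lambda>i. \<bar>\<alpha> i\<bar>)) \<and>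
        (((\<forall>k. \<rho> k + \<bar>\<delta> k\<bar> \<le> 1) \<and> bdd_above (range (\<lambda>i. norm (e i)))) \<or>
          summable (\<lambda>i. norm (\<delta> i *\<^sub>R e i))) \<and>
        ((\<forall>k. \<rho> k + \<bar>1 - \<beta> k - \<gamma> k\<bar> \<le> 1) \<or> summable (\<lambda>i. \<bar>1 - \<beta> i - \<gamma> i\<bar>)))
     \<or> ((\<forall>k. \<rho> k + \<bar>\<alpha> k\<bar> \<le> 1) \<and>
        summable (\<lambda>k. \<bar>1 - \<alpha> k - \<beta> k - \<gamma> k\<bar>) \<and>
        summable (\<lambda>k. norm (\<delta> k *\<^sub>R e k)))
     \<or> (bdd_above (range (\<lambda>k. norm (e k))) \<and>
        summable (\<lambda>k. \<bar>\<alpha> k\<bar>) \<and>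
        summable (\<lambda>k. \<bar>1 - \<beta> k - \<gamma> k - \<delta> k\<bar>) \<and>
        (\<forall>k. \<rho> k + \<bar>\<delta> k\<bar> \<le> 1))
     \<or> ((\<forall>k. \<alpha> k \<in> {0<..1} \<and> \<rho> k + \<alpha> k \<le> 1) \<and>
        (\<lambda>k. (\<delta> k *\<^sub>R e k) /\<^sub>R \<alpha> k) \<longlonglongrightarrow> 0 \<and>
        (\<lambda>k. (1 - \<alpha> k - \<beta> k - \<gamma> k) / \<alpha> k) \<longlonglongrightarrow> 0)"
      (is "?I \<or> ?II \<or> ?III \<or> ?IV \<or> ?V")
  shows "(\<forall>\<^sub>F k in sequentially. \<rho> k \<le> 1) \<and>
    absorbable \<rho> (\<lambda>k. norm (\<alpha> k *\<^sub>R u + \<delta> k *\<^sub>R e k - (1 - \<beta> k - \<gamma> k) *\<^sub>R p))"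
    (is "_ \<and> absorbable \<rho> ?r")
proof -
  define r where "r k = \<alpha> k *\<^sub>R u + \<delta> k *\<^sub>R e k - (1 - \<beta> k - \<gamma> k) *\<^sub>R p" for k
  have tri: "norm (a + b - d) \<le> norm a + norm b + norm d" for a b d :: 'a
    by (intro order_trans[OF norm_triangle_ineq4] add_right_mono norm_triangle_ineq)
  have bound1: "norm (r k) \<le> \<bar>\<alpha> k\<bar> * norm u + norm (\<delta> k *\<^sub>R e k) + \<bar>1 - \<beta> k - \<gamma> k\<bar> * norm p" for k
    unfolding r_def using tri[of "\<alpha> k *\<^sub>R u" "\<delta> k *\<^sub>R e k" "(1 - \<beta> k - \<gamma> k) *\<^sub>R p"] by simp
  have bound2: "norm (r k) \<le> \<bar>\<alpha> k\<bar> * norm (u - p) + norm (\<delta> k *\<^sub>R e k) + \<bar>1 - \<alpha> k - \<beta> k - \<gamma> k\<bar> * norm p" for k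
  proof -
    have "r k = \<alpha> k *\<^sub>R (u - p) + \<delta> k *\<^sub>R e k - (1 - \<alpha> k - \<beta> k - \<gamma> k) *\<^sub>R p"
      by (simp add: r_def algebra_simps)
    then show ?thesis using tri[of "\<alpha> k *\<^sub>R (u - p)" "\<delta> k *\<^sub>R e k" "(1 - \<alpha> k - \<beta> k - \<gamma> k) *\<^sub>R p"] by simp
  qed
  have bound3: "norm (r k) \<le> \<bar>\<alpha> k\<bar> * norm u + \<bar>\<delta> k\<bar> * norm (e k - p) + \<bar>1 - \<beta> k - \<gamma> k - \<delta> k\<bar> * norm p" for k
  proof -
    have "r k = \<alpha> k *\<^sub>R u + \<delta> k *\<^sub>R (e k - p) - (1 - \<beta> k - \<gamma> k - \<delta> k) *\<^sub>R p"
      by (simp add: r_def algebra_simps)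
    then show ?thesis using tri[of "\<alpha> k *\<^sub>R u" "\<delta> k *\<^sub>R (e k - p)" "(1 - \<beta> k - \<gamma> k - \<delta> k) *\<^sub>R p"] by simp
  qed
  have main: "(\<forall>\<^sub>F k in sequentially. \<rho> k \<le> 1) \<and> absorbable \<rho> (\<lambda>k. norm (r k))"
    using cases
  proof (elim disjE)
    assume h: ?I
    then obtain q where q: "q < 1" "\<forall>\<^sub>F k in sequentially. \<rho> k < q"
      by (auto elim: real_limsup_less_oneE)
    obtain B D where B: "\<And>k. \<bar>\<alpha> k\<bar> \<le> B" and D: "\<And>k. norm (\<delta> k *\<^sub>R e k) \<le> D"
      using h by (auto simp: bdd_above_def)
    \<comment> \<open>The whole residual is bounded, and \<open>1 - \<rho> k\<close> is eventually larger than \<open>1 - q > 0\<close>.\<close>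
    define R where "R = B * norm u + D + 2 * norm p"
    have "0 \<le> B" "0 \<le> D"
      using order_trans[OF abs_ge_zero B] order_trans[OF norm_ge_zero D] by blast+
    then have R: "0 \<le> R" by (simp add: R_def)
    have "\<forall>\<^sub>F k in sequentially. norm (r k) \<le> (1 - \<rho> k) * (R / (1 - q))"
      using q(2)
    proof eventually_elim
      case (elim k)
      have "\<bar>1 - \<beta> k - \<gamma> k\<bar> \<le> 2" using elim q(1) \<rho>[of k] by linarith
      then have "norm (r k) \<le> R"
        using bound1[of k] B[of k] D[of k] mult_right_mono[OF B norm_ge_zero, of k u]
          mult_right_mono[of "\<bar>1 - \<beta> k - \<gamma> k\<bar>" 2 "norm p"] by (simp add: R_def)
      also have "R = (1 - q) * (R / (1 - q))" using q by simp
      also have "\<dots> \<le> (1 - \<rho> k) * (R / (1 - q))"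
        using elim q R by (intro mult_right_mono) auto
      finally show ?case .
    qed
    moreover have "\<forall>\<^sub>F k in sequentially. \<rho> k \<le> 1"
      using q(2) by eventually_elim (use q(1) in linarith)
    ultimately show ?thesis by (blast intro: absorbable_if_le_slack)
  next
    assume h: ?II
    have "absorbable \<rho> (\<lambda>k. norm (\<delta> k *\<^sub>R e k))"
    proof (cases "summable (\<lambda>i. norm (\<delta> i *\<^sub>R e i))")
      case True
      then show ?thesis by (rule absorbable_if_summable) simp
    next
      case False
      then obtain E where E: "\<And>i. norm (e i) \<le> E"
        using h by (auto simp: bdd_above_def)
      have "0 \<le> E" using order_trans[OF norm_ge_zero E] .
      then have "absorbable \<rho> (\<lambda>k. \<bar>\<delta> k\<bar> * E)"
        using h False by (intro absorbable_scaled) auto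
      then show ?thesis
        by (rule absorbable_mono) (simp add: mult_left_mono E)
    qed
    then have "absorbable \<rho> (\<lambda>k. \<bar>\<alpha> k\<bar> * norm u + norm (\<delta> k *\<^sub>R e k) + \<bar>1 - \<beta> k - \<gamma> k\<bar> * norm p)"
      using h by (intro absorbable_add absorbable_scaled) auto
    then have "absorbable \<rho> (\<lambda>k. norm (r k))"
      by (rule absorbable_mono) (rule bound1)
    then show ?thesis using h by simp
  next
    assume h: ?III
    then have "absorbable \<rho> (\<lambda>k. \<bar>\<alpha> k\<bar> * norm (u - p) + norm (\<delta> k *\<^sub>R e k) + \<bar>1 - \<alpha> k - \<beta> k - \<gamma> k\<bar> * norm p)"
      by (intro absorbable_add absorbable_scaled absorbable_if_summable) auto
    then have "absorbable \<rho> (\<lambda>k. norm (r k))"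
      by (rule absorbable_mono) (rule bound2)
    moreover have "\<rho> k \<le> 1" for k using h abs_ge_zero[of "\<alpha> k"] by (smt (verit))
    ultimately show ?thesis by simp
  next
    assume h: ?IV
    then obtain E where E: "\<And>i. norm (e i) \<le> E"
      by (auto simp: bdd_above_def)
    then have "0 \<le> E" using order_trans[OF norm_ge_zero E] by blast
    have e: "norm (e k - p) \<le> E + norm p" for k
      using norm_triangle_ineq4[of "e k" p] E[of k] by linarith
    have "absorbable \<rho> (\<lambda>k. \<bar>\<alpha> k\<bar> * norm u + \<bar>\<delta> k\<bar> * (E + norm p) + \<bar>1 - \<beta> k - \<gamma> k - \<delta> k\<bar> * norm p)"
      using h \<open>0 \<le> E\<close> by (intro absorbable_add absorbable_scaled) auto
    then have "absorbable \<rho> (\<lambda>k. norm (r k))"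
    proof (rule absorbable_mono)
      show "norm (r k) \<le> \<bar>\<alpha> k\<bar> * norm u + \<bar>\<delta> k\<bar> * (E + norm p) + \<bar>1 - \<beta> k - \<gamma> k - \<delta> k\<bar> * norm p" for k
        using bound3[of k] mult_left_mono[OF e, of "\<bar>\<delta> k\<bar>" k] by simp
    qed
    moreover have "\<rho> k \<le> 1" for k using h abs_ge_zero[of "\<delta> k"] by (smt (verit))
    ultimately show ?thesis by simp
  next
    assume h: ?V
    \<comment> \<open>Every term of the residual is at most a constant times \<open>\<alpha> k\<close>, and \<open>\<alpha> k \<le> 1 - \<rho> k\<close>.\<close>
    then have "Bseq (\<lambda>k. (\<delta> k *\<^sub>R e k) /\<^sub>R \<alpha> k)" "Bseq (\<lambda>k. (1 - \<alpha> k - \<beta> k - \<gamma> k) / \<alpha> k)"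
      by (blast intro: convergent_imp_Bseq convergentI)+
    then obtain D L where D: "0 < D" "\<forall>k. norm ((\<delta> k *\<^sub>R e k) /\<^sub>R \<alpha> k) \<le> D"
      and L: "0 < L" "\<forall>k. norm ((1 - \<alpha> k - \<beta> k - \<gamma> k) / \<alpha> k) \<le> L"
      by (elim BseqE) blast
    define R where "R = norm (u - p) + D + L * norm p"
    have "norm (r k) \<le> (1 - \<rho> k) * R" for k
    proof -
      have \<alpha>: "0 < \<alpha> k" "\<alpha> k \<le> 1 - \<rho> k" using h by (auto simp: algebra_simps)
      have "norm (\<delta> k *\<^sub>R e k) \<le> \<alpha> k * D"
        using spec[OF D(2), of k] \<alpha> by (simp add: field_simps)
      moreover have "\<bar>1 - \<alpha> k - \<beta> k - \<gamma> k\<bar> * norm p \<le> (\<alpha> k * L) * norm p"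
        using spec[OF L(2), of k] \<alpha> by (intro mult_right_mono) (auto simp: field_simps)
      ultimately have "norm (r k) \<le> \<alpha> k * R"
        using bound2[of k] \<alpha> by (simp add: R_def algebra_simps)
      also have "\<dots> \<le> (1 - \<rho> k) * R"
        using \<alpha> D L by (intro mult_right_mono) (auto simp: R_def)
      finally show ?thesis .
    qed
    moreover have "\<rho> k \<le> 1" for k
    proof -
      have "0 < \<alpha> k" "\<rho> k + \<alpha> k \<le> 1" using h by auto
      then show ?thesis by linarith
    qed
    ultimately show ?thesis
      by (intro conjI absorbable_if_le_slack always_eventually allI)
  qed
  then show ?thesis unfolding r_def .
qed

section \<open>Boundedness characterises the existence of zeros\<close>

theorem theorem3p12:
  fixes A :: "'a::{real_inner, complete_space} \<Rightarrow> 'a set"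
    and u :: 'a
    and x e :: "nat \<Rightarrow> 'a"
    and c \<alpha> \<beta> \<gamma> \<delta> :: "nat \<Rightarrow> real"
  assumes nontrivial: "(UNIV :: 'a set) \<noteq> {0}"
    and maxmon: "maximally_monotone A"
    and c_pos: "\<forall>k. c k > 0"
    and iter: "\<forall>k. x (Suc k) =
        \<alpha> k *\<^sub>R u + \<beta> k *\<^sub>R x k + \<gamma> k *\<^sub>R resolvent (scale_operator (c k) A) (x k) + \<delta> k *\<^sub>R e k"
    and I_to_V:
      "(limsup (\<lambda>k. ereal (\<bar>\<beta> k + \<gamma> k / 2\<bar> + \<bar>\<gamma> k / 2\<bar>)) < 1 \<and>
        bdd_above (range (\<lambda>k. \<bar>\<alpha> k\<bar>)) \<and>
        bdd_above (range (\<lambda>k. norm (\<delta> k *\<^sub>R e k))))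
     \<or> ((\<forall>k. \<bar>\<beta> k + \<gamma> k / 2\<bar> + \<bar>\<gamma> k / 2\<bar> \<le> 1) \<and>
        ((\<forall>k. \<bar>\<alpha> k\<bar> + \<bar>\<beta> k + \<gamma> k / 2\<bar> + \<bar>\<gamma> k / 2\<bar> \<le> 1) \<or>
          summable (\<lambda>i. \<bar>\<alpha> i\<bar>)) \<and>
        (((\<forall>k. \<bar>\<beta> k + \<gamma> k / 2\<bar> + \<bar>\<gamma> k / 2\<bar> + \<bar>\<delta> k\<bar> \<le> 1) \<and>
            bdd_above (range (\<lambda>i. norm (e i)))) \<or>
          summable (\<lambda>i. norm (\<delta> i *\<^sub>R e i))) \<and>
        ((\<forall>k. \<bar>\<beta> k + \<gamma> k / 2\<bar> + \<bar>\<gamma> k / 2\<bar> + \<bar>1 - \<beta> k - \<gamma> k\<bar> \<le> 1) \<or>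
          summable (\<lambda>i. \<bar>1 - \<beta> i - \<gamma> i\<bar>)))
     \<or> ((\<forall>k. \<bar>\<alpha> k\<bar> + \<bar>\<beta> k + \<gamma> k / 2\<bar> + \<bar>\<gamma> k / 2\<bar> \<le> 1) \<and>
        summable (\<lambda>k. \<bar>1 - \<alpha> k - \<beta> k - \<gamma> k\<bar>) \<and>
        summable (\<lambda>k. norm (\<delta> k *\<^sub>R e k)))
     \<or> (bdd_above (range (\<lambda>k. norm (e k))) \<and>
        summable (\<lambda>k. \<bar>\<alpha> k\<bar>) \<and>
        summable (\<lambda>k. \<bar>1 - \<beta> k - \<gamma> k - \<delta> k\<bar>) \<and>
        (\<forall>k. \<bar>\<beta> k + \<gamma> k / 2\<bar> + \<bar>\<gamma> k / 2\<bar> + \<bar>\<delta> k\<bar> \<le> 1))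
     \<or> ((\<forall>k. \<alpha> k \<in> {0<..1} \<and> \<alpha> k + \<bar>\<beta> k + \<gamma> k / 2\<bar> + \<bar>\<gamma> k / 2\<bar> \<le> 1) \<and>
        (\<lambda>k. (\<delta> k *\<^sub>R e k) /\<^sub>R \<alpha> k) \<longlonglongrightarrow> 0 \<and>
        (\<lambda>k. (1 - \<alpha> k - \<beta> k - \<gamma> k) / \<alpha> k) \<longlonglongrightarrow> 0)"
  shows
    "(zer A \<noteq> {} \<longrightarrow> bounded (range x)) \<and>
     ( ((filterlim c at_top sequentially \<and>
         \<alpha> \<longlonglongrightarrow> 0 \<and> \<beta> \<longlonglongrightarrow> 0 \<and> \<gamma> \<longlonglongrightarrow> 1 \<and>
         (\<lambda>k. \<delta> k *\<^sub>R e k) \<longlonglongrightarrow> 0)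
      \<or> ((\<forall>k. \<beta> k + \<gamma> k \<le> 1) \<and>
         \<alpha> \<longlonglongrightarrow> 0 \<and>
         limsup (\<lambda>k. ereal \<bar>\<beta> k\<bar>) < 1 \<and>
         (\<lambda>k. 1 - \<alpha> k - \<beta> k - \<gamma> k) \<longlonglongrightarrow> 0 \<and>
         0 < liminf (\<lambda>k. ereal (1 - \<beta> k - \<gamma> k / 2)) \<and>
         liminf (\<lambda>k. ereal (1 - \<beta> k - \<gamma> k / 2)) \<le> limsup (\<lambda>k. ereal (1 - \<beta> k - \<gamma> k / 2)) \<and>
         limsup (\<lambda>k. ereal (1 - \<beta> k - \<gamma> k / 2)) < 1 \<and>
         (\<lambda>k. \<delta> k *\<^sub>R e k) \<longlonglongrightarrow> 0 \<and>
         (\<lambda>k. 1 - c k / c (Suc k)) \<longlonglongrightarrow> 0 \<and>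
         ((INF k. c k) > 0 \<or> filterlim c at_top sequentially))
      \<or> ((summable (\<lambda>i. \<bar>\<alpha> (Suc i) - \<alpha> i\<bar>) \<or>
           ((\<forall>k. \<bar>\<gamma> k\<bar> \<noteq> 1) \<and>
            (\<lambda>k. \<bar>\<alpha> (Suc k) - \<alpha> k\<bar> / (1 - \<bar>\<gamma> (Suc k)\<bar>)) \<longlonglongrightarrow> 0)) \<and>
         (\<forall>k. \<bar>\<gamma> k\<bar> \<in> {0..1}) \<and>
         \<alpha> \<longlonglongrightarrow> 0 \<and> (\<lambda>k. \<alpha> k + \<gamma> k) \<longlonglongrightarrow> 1 \<and>
         summable (\<lambda>k. \<bar>(\<alpha> (Suc k) + \<gamma> (Suc k)) - (\<alpha> k + \<gamma> k)\<bar>) \<and>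
         summable (\<lambda>k. \<bar>\<beta> k\<bar>) \<and>
         filterlim (\<lambda>n. \<Sum>k<n. 1 - \<bar>\<gamma> k\<bar>) at_top sequentially \<and>
         summable (\<lambda>k. norm (\<delta> k *\<^sub>R e k)) \<and>
         (INF k. c k) > 0 \<and>
         summable (\<lambda>k. \<bar>c (Suc k) - c k\<bar>)))
       \<longrightarrow> (zer A \<noteq> {} \<longleftrightarrow> bounded (range x)))"
proof (intro conjI impI)
  have c: "c k > 0" for k using c_pos by simp
  have iter': "x (Suc k) =
      \<alpha> k *\<^sub>R u + \<beta> k *\<^sub>R x k + \<gamma> k *\<^sub>R resolvent (scale_operator (c k) A) (x k) + \<delta> k *\<^sub>R e k" for k
    using iter by blast
  have bounded_iff: "bounded (range x) \<longleftrightarrow> Bseq x"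
    by (simp add: Elementary_Normed_Spaces.Bseq_eq_bounded)
  define \<rho> where "\<rho> k = \<bar>\<beta> k + \<gamma> k / 2\<bar> + \<bar>\<gamma> k / 2\<bar>" for k
  have \<rho>_last: "t + \<bar>\<beta> k + \<gamma> k / 2\<bar> + \<bar>\<gamma> k / 2\<bar> = \<rho> k + t" for t k
    by (simp add: \<rho>_def)
  show bounded: "bounded (range x)" if nonempty: "zer A \<noteq> {}"
  proof -
    obtain p where p: "p \<in> zer A" using nonempty by blast
    note residual_absorbable[OF \<rho>_def I_to_V[unfolded \<rho>_last, folded \<rho>_def], of u p]
    then show ?thesis
      unfolding bounded_iff
      by (elim conjE) (rule iteration_bounded_if_residual_absorbable[where A = A and c = c and x = x
            and u = u and e = e and \<alpha> = \<alpha> and \<beta> = \<beta> and \<gamma> = \<gamma> and \<delta> = \<delta> and \<rho> = \<rho>, OF maxmon c p iter' \<rho>_def])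
  qed
  assume conv: "(filterlim c at_top sequentially \<and>
        \<alpha> \<longlonglongrightarrow> 0 \<and> \<beta> \<longlonglongrightarrow> 0 \<and> \<gamma> \<longlonglongrightarrow> 1 \<and>
        (\<lambda>k. \<delta> k *\<^sub>R e k) \<longlonglongrightarrow> 0)
      \<or> ((\<forall>k. \<beta> k + \<gamma> k \<le> 1) \<and>
        \<alpha> \<longlonglongrightarrow> 0 \<and>
        limsup (\<lambda>k. ereal \<bar>\<beta> k\<bar>) < 1 \<and>
        (\<lambda>k. 1 - \<alpha> k - \<beta> k - \<gamma> k) \<longlonglongrightarrow> 0 \<and>
        0 < liminf (\<lambda>k. ereal (1 - \<beta> k - \<gamma> k / 2)) \<and>
        liminf (\<lambda>k. ereal (1 - \<beta> k - \<gamma> k / 2)) \<le> limsup (\<lambda>k. ereal (1 - \<beta> k - \<gamma> k / 2)) \<and>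
        limsup (\<lambda>k. ereal (1 - \<beta> k - \<gamma> k / 2)) < 1 \<and>
        (\<lambda>k. \<delta> k *\<^sub>R e k) \<longlonglongrightarrow> 0 \<and>
        (\<lambda>k. 1 - c k / c (Suc k)) \<longlonglongrightarrow> 0 \<and>
        ((INF k. c k) > 0 \<or> filterlim c at_top sequentially))
      \<or> ((summable (\<lambda>i. \<bar>\<alpha> (Suc i) - \<alpha> i\<bar>) \<or>
        ((\<forall>k. \<bar>\<gamma> k\<bar> \<noteq> 1) \<and>
        (\<lambda>k. \<bar>\<alpha> (Suc k) - \<alpha> k\<bar> / (1 - \<bar>\<gamma> (Suc k)\<bar>)) \<longlonglongrightarrow> 0)) \<and>
        (\<forall>k. \<bar>\<gamma> k\<bar> \<in> {0..1}) \<and>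
        \<alpha> \<longlonglongrightarrow> 0 \<and> (\<lambda>k. \<alpha> k + \<gamma> k) \<longlonglongrightarrow> 1 \<and>
        summable (\<lambda>k. \<bar>(\<alpha> (Suc k) + \<gamma> (Suc k)) - (\<alpha> k + \<gamma> k)\<bar>) \<and>
        summable (\<lambda>k. \<bar>\<beta> k\<bar>) \<and>
        filterlim (\<lambda>n. \<Sum>k<n. 1 - \<bar>\<gamma> k\<bar>) at_top sequentially \<and>
        summable (\<lambda>k. norm (\<delta> k *\<^sub>R e k)) \<and>
        (INF k. c k) > 0 \<and>
        summable (\<lambda>k. \<bar>c (Suc k) - c k\<bar>))"
      (is "?a \<or> ?b \<or> ?c")
  have near_one: "\<exists>g>0. \<forall>\<^sub>F k in sequentially. g \<le> \<gamma> k \<and> \<gamma> k \<le> 2" if "\<gamma> \<longlonglongrightarrow> 1"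
  proof -
    have "\<forall>\<^sub>F k in sequentially. 1/2 \<le> \<gamma> k \<and> \<gamma> k \<le> 2"
      using order_tendstoD(1)[OF that, of "1/2", simplified] order_tendstoD(2)[OF that, of 2, simplified]
      by eventually_elim linarith
    then show ?thesis by (intro exI[of _ "1/2"]) simp
  qed
  have lower: "\<exists>m>0. \<forall>\<^sub>F k in sequentially. m \<le> c k" if "(INF k. c k) > 0 \<or> filterlim c at_top sequentially"
    using that
  proof
    assume "(INF k. c k) > 0"
    moreover have "(INF k. c k) \<le> c k" for k
      by (intro cINF_lower bdd_belowI2[of _ 0] less_imp_le c UNIV_I)
    ultimately show ?thesis
      by (intro exI[of _ "INF k. c k"] conjI always_eventually allI)
  next
    assume "filterlim c at_top sequentially"
    then have "\<forall>\<^sub>F k in sequentially. 1 \<le> c k"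
      unfolding filterlim_at_top by blast
    then show ?thesis by (intro exI[of _ 1] conjI) simp_all
  qed
  from conv have "\<alpha> \<longlonglongrightarrow> 0 \<and> (\<lambda>k. \<beta> k + \<gamma> k) \<longlonglongrightarrow> 1 \<and> (\<lambda>k. \<delta> k *\<^sub>R e k) \<longlonglongrightarrow> 0 \<and>
    (\<exists>g>0. \<forall>\<^sub>F k in sequentially. g \<le> \<gamma> k \<and> \<gamma> k \<le> 2) \<and>
    (\<exists>m>0. \<forall>\<^sub>F k in sequentially. m \<le> c k)"
  proof (elim disjE)
    assume h: ?a
    then have "(\<lambda>k. \<beta> k + \<gamma> k) \<longlonglongrightarrow> 0 + 1" by (intro tendsto_add) auto
    then show ?thesis using h near_one lower by simp
  next
    assume h: ?b
    have "(\<lambda>k. 1 - \<alpha> k - (1 - \<alpha> k - \<beta> k - \<gamma> k)) \<longlonglongrightarrow> 1 - 0 - 0"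
      using h by (intro tendsto_diff tendsto_const) auto
    then have sum: "(\<lambda>k. \<beta> k + \<gamma> k) \<longlonglongrightarrow> 1" by simp
    \<comment> \<open>Since \<open>1 - \<beta> - \<gamma>/2 = (1 - \<beta> - \<gamma>) + \<gamma>/2\<close> and the bracket vanishes in the limit, bounds on the
      left-hand side strictly between 0 and 1 become bounds on \<open>\<gamma>\<close> strictly between 0 and 2.\<close>
    obtain q q' where q: "0 < q" "\<forall>\<^sub>F k in sequentially. q < 1 - \<beta> k - \<gamma> k / 2"
      and q': "q' < 1" "\<forall>\<^sub>F k in sequentially. 1 - \<beta> k - \<gamma> k / 2 < q'"
    proof -
      obtain q where "0 < q" "\<forall>\<^sub>F k in sequentially. q < 1 - \<beta> k - \<gamma> k / 2"
        using h by (elim conjE) (rule real_liminf_posE)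
      moreover obtain q' where "q' < 1" "\<forall>\<^sub>F k in sequentially. 1 - \<beta> k - \<gamma> k / 2 < q'"
        using h by (elim conjE) (rule real_limsup_less_oneE)
      ultimately show thesis by (rule that)
    qed
    have "\<forall>\<^sub>F k in sequentially. 1 - q / 2 < \<beta> k + \<gamma> k" "\<forall>\<^sub>F k in sequentially. \<beta> k + \<gamma> k < 2 - q'"
      by (rule order_tendstoD[OF sum], use q(1) q'(1) in linarith)+
    with q(2) q'(2) have "\<forall>\<^sub>F k in sequentially. q \<le> \<gamma> k \<and> \<gamma> k \<le> 2"
      by eventually_elim linarith
    then have "\<exists>g>0. \<forall>\<^sub>F k in sequentially. g \<le> \<gamma> k \<and> \<gamma> k \<le> 2"
      using q(1) by blast
    moreover have "\<exists>m>0. \<forall>\<^sub>F k in sequentially. m \<le> c k"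
      using h by (intro lower) (elim conjE)
    ultimately show ?thesis using h sum by (elim conjE) (intro conjI)
  next
    assume h: ?c
    have "(\<lambda>k. (\<alpha> k + \<gamma> k) - \<alpha> k) \<longlonglongrightarrow> 1 - 0"
      using h by (intro tendsto_diff) auto
    then have \<gamma>: "\<gamma> \<longlonglongrightarrow> 1" by simp
    have "\<beta> \<longlonglongrightarrow> 0"
      using h by (elim conjE) (rule tendsto_rabs_zero_cancel[OF summable_LIMSEQ_zero])
    then have "(\<lambda>k. \<beta> k + \<gamma> k) \<longlonglongrightarrow> 0 + 1" using \<gamma> by (rule tendsto_add)
    moreover have "(\<lambda>k. \<delta> k *\<^sub>R e k) \<longlonglongrightarrow> 0"
      using h by (elim conjE) (rule tendsto_norm_zero_cancel[OF summable_LIMSEQ_zero])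
    ultimately show ?thesis using h near_one[OF \<gamma>] lower by simp
  qed
  then obtain g m where lim: "\<alpha> \<longlonglongrightarrow> 0" "(\<lambda>k. \<beta> k + \<gamma> k) \<longlonglongrightarrow> 1" "(\<lambda>k. \<delta> k *\<^sub>R e k) \<longlonglongrightarrow> 0"
    and g: "0 < g" "\<forall>\<^sub>F k in sequentially. g \<le> \<gamma> k \<and> \<gamma> k \<le> 2"
    and m: "0 < m" "\<forall>\<^sub>F k in sequentially. m \<le> c k"
    by (elim conjE exE)
  have "zer A \<noteq> {}" if "bounded (range x)"
    using that unfolding bounded_iff
    by (rule zer_nonempty_if_bounded_iteration[where A = A and c = c and x = x and u = u and e = e
          and \<alpha> = \<alpha> and \<beta> = \<beta> and \<gamma> = \<gamma> and \<delta> = \<delta>, OF maxmon c iter' lim g m])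
  with bounded show "zer A \<noteq> {} \<longleftrightarrow> bounded (range x)"
    by (rule iffI)
qed

end
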